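(* Let $\omega = p(x,y)\,dx + q(x,y)\,dy$ be a differential one-form on $\mathbb{R}^2$ with real polynomial coefficients, and let $n = \deg\omega$. Let $I(t) = \oint_{\delta(t)} \omega$ for $t \in (0, \frac{1}{64})$, where $\delta(t)$ is the compact connected component of the level curve $\{(x,y)\in\mathbb{R}^2 : x^2y(1-x-y) = t\}$. Then the number of isolated zeros of $I$ on the interval $(0,\frac{1}{64})$ does not exceed $\frac{7}{4}n + 9$.
   Context: Let $H(x,y) = x^2y(1-x-y)$. For $t\in(0,\frac1{64})$, $\delta(t)\subset\mathbb{R}^2$ denotes the compact connected component (oval) of the level curve $\{H=t\}$; these form a continuous family of simple closed curves lying in $\{x>0,\ y>0\}$, oriented continuously in $t$. The degree $\deg\omega$ of a polynomial one-form $\omega=p\,dx+q\,dy$ is the maximum of the degrees of its coefficients $p,q$. *)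

theory Defs
  imports "HOL-Analysis.Analysis" "HOL-Computational_Algebra.Polynomial"
begin

text \<open>A polynomial in \<open>x, y\<close> with real coefficients is a \<^typ>\<open>real poly poly\<close>: the outer
  variable is \<open>y\<close>, the inner one is \<open>x\<close>, so the coefficient of \<open>x ^ i * y ^ j\<close> in \<open>P\<close> is
  \<open>coeff (coeff P j) i\<close>.\<close>

definition eval2 :: "real poly poly \<Rightarrow> real \<times> real \<Rightarrow> real" where
  "eval2 P z = poly (poly P [:snd z:]) (fst z)"

text \<open>The zero polynomial gets degree \<open>0\<close>, as for \<^const>\<open>degree\<close>.\<close>

definition total_degree :: "real poly poly \<Rightarrow> nat" where
  "total_degree P = Max (insert 0 {i + j | i j. coeff (coeff P j) i \<noteq> 0})"

lemma finite_total_degree_set: "finite {i + j | i j. coeff (coeff P j) i \<noteq> 0}"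
proof (rule finite_subset)
  show "{i + j | i j. coeff (coeff P j) i \<noteq> 0}
    \<subseteq> (\<Union>j\<in>{..degree P}. (\<lambda>i. i + j) ` {..degree (coeff P j)})"
  proof
    fix k assume "k \<in> {i + j | i j. coeff (coeff P j) i \<noteq> 0}"
    then obtain i j where k: "k = i + j" and nz: "coeff (coeff P j) i \<noteq> 0" by blast
    from nz have "i \<le> degree (coeff P j)" by (rule le_degree)
    moreover from nz have "coeff P j \<noteq> 0" by auto
    then have "j \<le> degree P" by (rule le_degree)
    ultimately show "k \<in> (\<Union>j\<in>{..degree P}. (\<lambda>i. i + j) ` {..degree (coeff P j)})"
      using k by auto
  qed
qed auto

definition form_degree :: "real poly poly \<Rightarrow> real poly poly \<Rightarrow> nat" where
  "form_degree p q = max (total_degree p) (total_degree q)"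

definition line_integral ::
    "real poly poly \<Rightarrow> real poly poly \<Rightarrow> (real \<Rightarrow> real \<times> real) \<Rightarrow> real" where
  "line_integral p q g = integral {0..1} (\<lambda>s.
     eval2 p (g s) * fst (vector_derivative g (at s within {0..1})) +
     eval2 q (g s) * snd (vector_derivative g (at s within {0..1})))"

definition H :: "real \<times> real \<Rightarrow> real" where
  "H = (\<lambda>(x, y). x\<^sup>2 * y * (1 - x - y))"

definition oval :: "real \<Rightarrow> (real \<times> real) set" where
  "oval t = (THE C. C \<in> components {z. H z = t} \<and> compact C)"

text \<open>A parametrization of the ovals as a continuous family of piecewise continuously
  differentiable simple closed curves. Joint continuity in \<open>(t, s)\<close> is what makes the orientation
  of \<open>oval t\<close> depend continuously on \<open>t\<close>; which of the two continuous orientations is chosen is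
  left open. An example is, with \<open>a = sqrt (1/4 - 2 * sqrt t)\<close> and \<open>\<phi> = 2 * pi * s\<close>,
  \<open>x = 1/2 + a * cos \<phi>\<close> and \<open>y = (1 - x + a * sin \<phi> * sqrt (x * (1 - x) + 2 * sqrt t) / x) / 2\<close>.\<close>

definition oval_family :: "(real \<Rightarrow> real \<Rightarrow> real \<times> real) \<Rightarrow> bool" where
  "oval_family \<gamma> \<longleftrightarrow>
     continuous_on ({0<..<1/64} \<times> {0..1}) (\<lambda>(t, s). \<gamma> t s) \<and>
     (\<forall>t\<in>{0<..<1/64}. valid_path (\<gamma> t) \<and> simple_path (\<gamma> t) \<and>
        pathfinish (\<gamma> t) = pathstart (\<gamma> t) \<and> path_image (\<gamma> t) = oval t)"

end

theory Submission
  imports Defs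
begin

text \<open>
  Put \<open>s = 2 * sqrt t\<close>, \<open>z = x * (1 - x)\<close> and \<open>v = x * (2 * y - 1 + x)\<close>. The level curve \<open>H = t\<close>
  becomes \<open>v\<^sup>2 = z\<^sup>2 - s\<^sup>2\<close>, a genus one curve that is symmetric under \<open>x \<mapsto> 1 - x\<close>, and the oval is its
  part over \<open>0 < x < 1\<close>. It has an explicit smooth parametrization by an angle. The other components of
  the level curve are unbounded, and every simple closed parametrization of the oval is a reparametrization
  of the explicit one, so that \<open>I t\<close> is a nonzero multiple of the integral over the explicit curve
  (lemmas \<open>oval_eq\<close> and \<open>line_integral_oval\<close>). Only the zeros of \<open>I\<close> matter, hence the
  multiple does not.

  Since \<open>y = (1 - x + v / x) / 2\<close>, the integral of a form of degree \<open>n\<close> is a combination of integrals of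
  \<open>x ^ a * v ^ l dx\<close> with \<open>a \<ge> - l\<close> and \<open>a + 2 * l \<le> n + 1\<close>. Integrating exact forms
  yields recurrences which, together with the symmetry, reduce all of them to
  \<open>c(t) * K + a(t) * B0 + b(t) * B1\<close>, where \<open>K\<close>, \<open>B0\<close>, \<open>B1\<close> are the integrals of \<open>v / z\<close>, \<open>v\<close>, \<open>z * v\<close>
  and \<open>a\<close>, \<open>b\<close>, \<open>c\<close> are polynomials of degree at most \<open>n / 4\<close> (lemma \<open>petrov_module_form_int\<close>).
  The weights \<open>1\<close>, \<open>2\<close>, \<open>4\<close> of \<open>x\<close>, \<open>v\<close>, \<open>t\<close> are responsible for the factor \<open>1 / 4\<close>.

  The integral \<open>K\<close> is of the third kind, but the derivative of \<open>K / sqrt t\<close> is not. Therefore the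
  derivative of \<open>I / (c * sqrt t)\<close> is, up to a nonvanishing factor off the zeros of \<open>c\<close>, of the form
  \<open>F = t * P * A0 + Q * A1\<close>, where \<open>A0\<close>, \<open>A1\<close> are the integrals of \<open>1 / v\<close>, \<open>z / v\<close> and \<open>P\<close>, \<open>Q\<close> are
  polynomials of degree about \<open>n / 2\<close>. The pair \<open>A0\<close>, \<open>A1\<close> solves a linear system, so the ratio \<open>A1 / A0\<close>
  solves a Riccati equation. Between two consecutive zeros of \<open>F\<close> there is a zero of \<open>Q\<close> or a point
  where the graph of \<open>- t * P / Q\<close> is tangent to the Riccati field, and these contact points are zeros
  of a polynomial of degree about \<open>n\<close>. Thus \<open>F\<close> has about \<open>n + n / 2\<close> zeros at most, and Rolle's theorem
  adds at most the \<open>n / 4\<close> zeros of \<open>c\<close>, which gives \<open>7 * n / 4\<close> up to a constant. In the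
  degenerate cases, such as a vanishing contact polynomial, \<open>F\<close> is identically zero or zero free on each
  interval between the zeros of \<open>Q\<close>, and the isolated zeros of \<open>I\<close> are counted interval by interval
  (lemmas \<open>ode_form_zeros\<close> and \<open>module_isolated_zeros\<close>).
\<close>

section \<open>An angular parametrization of the oval\<close>

text \<open>The functions below parametrize the oval \<open>H = s\<^sup>2 / 4\<close>, for \<open>0 < s < 1/4\<close>, by an angle \<open>\<phi>\<close>:
  \<open>xpar\<close> and \<open>ypar\<close> are the coordinates, \<open>zpar\<close> is \<open>x * (1 - x)\<close>, \<open>rpar\<close> is the square root of \<open>z + s\<close>,
  and \<open>vpar\<close> is \<open>v = x * (2 * y - 1 + x)\<close>; the prefix \<open>d\<close> marks derivatives with respect to \<open>\<phi>\<close>. The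
  factorization \<open>z\<^sup>2 - s\<^sup>2 = (z - s) * (z + s)\<close> with \<open>z - s = dxpar\<^sup>2\<close> is what makes \<open>v\<close> a smooth function of
  the angle.\<close>
definition zpar :: "real \<Rightarrow> real \<Rightarrow> real" where
  "zpar s \<phi> = s * (sin \<phi>)\<^sup>2 + (cos \<phi>)\<^sup>2 / 4"
definition rpar :: "real \<Rightarrow> real \<Rightarrow> real" where
  "rpar s \<phi> = sqrt (zpar s \<phi> + s)"
definition xpar :: "real \<Rightarrow> real \<Rightarrow> real" where
  "xpar s \<phi> = 1/2 + sqrt (1/4 - s) * sin \<phi>"
definition dxpar :: "real \<Rightarrow> real \<Rightarrow> real" where
  "dxpar s \<phi> = sqrt (1/4 - s) * cos \<phi>"
definition vpar :: "real \<Rightarrow> real \<Rightarrow> real" where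
  "vpar s \<phi> = dxpar s \<phi> * rpar s \<phi>"
definition ypar :: "real \<Rightarrow> real \<Rightarrow> real" where
  "ypar s \<phi> = (1 - xpar s \<phi> + vpar s \<phi> / xpar s \<phi>) / 2"

definition dvpar :: "real \<Rightarrow> real \<Rightarrow> real" where
  "dvpar s \<phi> = - sqrt (1/4 - s) * sin \<phi> * rpar s \<phi>
     - (1/4 - s) * sin \<phi> * cos \<phi> * dxpar s \<phi> / rpar s \<phi>"
definition dypar :: "real \<Rightarrow> real \<Rightarrow> real" where
  "dypar s \<phi> = (- dxpar s \<phi> + (dvpar s \<phi> * xpar s \<phi> - vpar s \<phi> * dxpar s \<phi>) / (xpar s \<phi>)\<^sup>2) / 2"

context
  fixes s :: real
  assumes s: "0 < s" "s < 1/4"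
begin

lemma amp_sq: "sqrt (1/4 - s) * sqrt (1/4 - s) = 1/4 - s"
  using s by simp

lemma amp_bounds: "0 < sqrt (1/4 - s)" "sqrt (1/4 - s) < 1/2"
proof -
  show "0 < sqrt (1/4 - s)" using s by simp
  have "sqrt (1/4 - s) < sqrt ((1/2)\<^sup>2)" using s by (subst real_sqrt_less_iff) (simp add: power2_eq_square)
  then show "sqrt (1/4 - s) < 1/2" by simp
qed

lemma zpar_ge: "s \<le> zpar s \<phi>"
proof -
  have "s * ((sin \<phi>)\<^sup>2 + (cos \<phi>)\<^sup>2) \<le> zpar s \<phi>"
    unfolding zpar_def distrib_left using s mult_right_mono[of s "1/4" "(cos \<phi>)\<^sup>2"] by simp
  then show ?thesis by simp
qed

lemma zpar_pos: "0 < zpar s \<phi>" using zpar_ge[of \<phi>] s by simp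

lemma rpar_pos: "0 < rpar s \<phi>" using zpar_pos[of \<phi>] s by (simp add: rpar_def)

lemma rpar_sq: "rpar s \<phi> * rpar s \<phi> = zpar s \<phi> + s"
  using zpar_pos[of \<phi>] s by (simp add: rpar_def)

lemma xpar_bounds: "0 < xpar s \<phi>" "xpar s \<phi> < 1"
proof -
  have "\<bar>sqrt (1/4 - s) * sin \<phi>\<bar> \<le> sqrt (1/4 - s) * 1"
    unfolding abs_mult using amp_bounds by (intro mult_mono) auto
  then have "\<bar>sqrt (1/4 - s) * sin \<phi>\<bar> < 1/2" using amp_bounds(2) by (simp del: abs_mult)
  then show "0 < xpar s \<phi>" "xpar s \<phi> < 1" unfolding xpar_def by linarith+
qed

lemma xpar_zpar: "xpar s \<phi> * (1 - xpar s \<phi>) = zpar s \<phi>"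
proof -
  have "xpar s \<phi> * (1 - xpar s \<phi>) = 1/4 - (sqrt (1/4 - s) * sqrt (1/4 - s)) * (sin \<phi>)\<^sup>2"
    by (simp add: xpar_def power2_eq_square algebra_simps)
  also have "\<dots> = zpar s \<phi>" unfolding amp_sq zpar_def cos_squared_eq by (simp add: field_simps)
  finally show ?thesis .
qed

lemma dxpar_sq: "dxpar s \<phi> * dxpar s \<phi> = zpar s \<phi> - s"
proof -
  have "dxpar s \<phi> * dxpar s \<phi> = (sqrt (1/4 - s) * sqrt (1/4 - s)) * (cos \<phi>)\<^sup>2"
    by (simp add: dxpar_def power2_eq_square algebra_simps)
  also have "\<dots> = zpar s \<phi> - s" unfolding amp_sq zpar_def sin_squared_eq by (simp add: field_simps)
  finally show ?thesis .
qed

lemma vpar_sq: "(vpar s \<phi>)\<^sup>2 = (zpar s \<phi>)\<^sup>2 - s\<^sup>2"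
proof -
  have "(vpar s \<phi>)\<^sup>2 = (dxpar s \<phi> * dxpar s \<phi>) * (rpar s \<phi> * rpar s \<phi>)"
    by (simp add: vpar_def power2_eq_square algebra_simps)
  then show ?thesis unfolding dxpar_sq rpar_sq by (simp add: power2_eq_square algebra_simps)
qed

lemma xpar_deriv: "(xpar s has_real_derivative dxpar s \<phi>) (at \<phi> within S)"
  unfolding xpar_def dxpar_def by (auto intro!: derivative_eq_intros)

lemma zpar_deriv: "(zpar s has_real_derivative (- 2 * (xpar s \<phi> - 1/2) * dxpar s \<phi>)) (at \<phi> within S)"
proof -
  have *: "- 2 * (xpar s \<phi> - 1/2) * dxpar s \<phi> = - 2 * (sqrt (1/4 - s) * sqrt (1/4 - s)) * sin \<phi> * cos \<phi>"
    by (simp add: xpar_def dxpar_def)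
  show ?thesis unfolding * amp_sq zpar_def
    by (auto intro!: derivative_eq_intros simp: algebra_simps)
qed

lemma rpar_deriv: "(rpar s has_real_derivative (- (xpar s \<phi> - 1/2) * dxpar s \<phi> / rpar s \<phi>)) (at \<phi> within S)"
proof -
  have "zpar s \<phi> + s > 0" using zpar_pos[of \<phi>] s by simp
  moreover have "rpar s = (\<lambda>\<phi>. sqrt (zpar s \<phi> + s))" by (simp add: rpar_def fun_eq_iff)
  ultimately show ?thesis
    by (auto intro!: derivative_eq_intros zpar_deriv simp: divide_simps) (simp add: algebra_simps)
qed

lemma dxpar_deriv: "(dxpar s has_real_derivative - (xpar s \<phi> - 1/2)) (at \<phi> within S)"
  unfolding xpar_def dxpar_def by (auto intro!: derivative_eq_intros)

lemma dvpar_eq: "dvpar s \<phi> = - (xpar s \<phi> - 1/2) * rpar s \<phi> - (xpar s \<phi> - 1/2) * dxpar s \<phi> * dxpar s \<phi> / rpar s \<phi>"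
proof -
  have "(xpar s \<phi> - 1/2) * dxpar s \<phi> = (sqrt (1/4 - s) * sqrt (1/4 - s)) * sin \<phi> * cos \<phi>"
    by (simp add: xpar_def dxpar_def)
  then have "(1/4 - s) * sin \<phi> * cos \<phi> = (xpar s \<phi> - 1/2) * dxpar s \<phi>" unfolding amp_sq by simp
  then show ?thesis by (simp add: dvpar_def xpar_def)
qed

lemma vpar_deriv: "(vpar s has_real_derivative dvpar s \<phi>) (at \<phi> within S)"
proof -
  have "vpar s = (\<lambda>\<phi>. dxpar s \<phi> * rpar s \<phi>)" by (simp add: vpar_def fun_eq_iff)
  then show ?thesis unfolding dvpar_eq
    by (auto intro!: derivative_eq_intros dxpar_deriv rpar_deriv simp: left_diff_distrib diff_divide_distrib)
qed

lemma dvpar_alt: "dvpar s \<phi> = - 2 * (xpar s \<phi> - 1/2) * zpar s \<phi> / rpar s \<phi>"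
proof -
  have "dvpar s \<phi> = - (xpar s \<phi> - 1/2) * (rpar s \<phi> * rpar s \<phi> + dxpar s \<phi> * dxpar s \<phi>) / rpar s \<phi>"
    unfolding dvpar_eq using rpar_pos[of \<phi>] by (simp add: field_simps)
  then show ?thesis unfolding rpar_sq dxpar_sq by simp
qed

lemma vpar_dvpar: "vpar s \<phi> * dvpar s \<phi> = - 2 * (xpar s \<phi> - 1/2) * dxpar s \<phi> * zpar s \<phi>"
  unfolding dvpar_alt vpar_def using rpar_pos[of \<phi>] by simp

lemma ypar_deriv: "(ypar s has_real_derivative dypar s \<phi>) (at \<phi> within S)"
proof -
  have "ypar s = (\<lambda>\<phi>. (1 - xpar s \<phi> + vpar s \<phi> / xpar s \<phi>) / 2)" by (simp add: ypar_def fun_eq_iff)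
  moreover have "((\<lambda>\<phi>. (1 - xpar s \<phi> + vpar s \<phi> / xpar s \<phi>) / 2) has_real_derivative
      (0 - dxpar s \<phi> + (dvpar s \<phi> * xpar s \<phi> - vpar s \<phi> * dxpar s \<phi>) / (xpar s \<phi> * xpar s \<phi>)) / 2) (at \<phi> within S)"
    using xpar_bounds(1)[of \<phi>]
    by (intro DERIV_cdivide DERIV_add DERIV_diff DERIV_divide DERIV_const xpar_deriv vpar_deriv) simp
  ultimately show ?thesis unfolding dypar_def power2_eq_square by simp
qed

lemma param_continuous [continuous_intros]:
  "continuous_on S (xpar s)" "continuous_on S (dxpar s)" "continuous_on S (zpar s)" "continuous_on S (rpar s)"
  "continuous_on S (vpar s)" "continuous_on S (ypar s)"
  by (rule DERIV_continuous_on, rule xpar_deriv dxpar_deriv zpar_deriv rpar_deriv vpar_deriv ypar_deriv)+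

lemma dvpar_continuous [continuous_intros]: "continuous_on S (dvpar s)"
proof -
  have "dvpar s = (\<lambda>\<phi>. - 2 * (xpar s \<phi> - 1/2) * zpar s \<phi> / rpar s \<phi>)" by (rule ext) (rule dvpar_alt)
  then show ?thesis
    by (elim ssubst) (intro continuous_intros ballI rpar_pos[THEN less_imp_neq, THEN not_sym])
qed

lemma dypar_continuous [continuous_intros]: "continuous_on S (dypar s)"
proof -
  have "dypar s = (\<lambda>\<phi>. (- dxpar s \<phi> + (dvpar s \<phi> * xpar s \<phi> - vpar s \<phi> * dxpar s \<phi>) / (xpar s \<phi>)\<^sup>2) / 2)"
    by (rule ext) (rule dypar_def)
  then show ?thesis
    by (elim ssubst) (intro continuous_intros dvpar_continuous ballI xpar_bounds(1)[THEN less_imp_neq, THEN not_sym] power_not_zero; simp)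
qed

end

text \<open>The integral over one turn. The interval is symmetric about \<open>0\<close>, because \<open>\<phi> \<mapsto> - \<phi>\<close> is the symmetry
  \<open>x \<mapsto> 1 - x\<close> of the oval.\<close>
definition cycle_int :: "(real \<Rightarrow> real) \<Rightarrow> real" where "cycle_int f = integral {-pi..pi} f"

lemma cycle_int_deriv_zero:
  assumes "\<And>\<phi>. (F has_real_derivative f \<phi>) (at \<phi> within {-pi..pi})" "F (-pi) = F pi"
  shows "cycle_int f = 0"
proof -
  have "(f has_integral (F pi - F (-pi))) {-pi..pi}"
    using assms(1) by (intro fundamental_theorem_of_calculus) (auto simp: has_real_derivative_iff_has_vector_derivative)
  then show ?thesis using assms(2) by (simp add: cycle_int_def integral_unique)
qed

lemma cycle_int_odd_zero:
  assumes "\<And>\<phi>. f (-\<phi>) = - f \<phi>"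
  shows "cycle_int f = 0"
proof -
  have "cycle_int f = integral {-pi..pi} (\<lambda>\<phi>. f (-\<phi>))"
    unfolding cycle_int_def using Henstock_Kurzweil_Integration.integral_reflect_real[of pi "-pi" f]
    by (simp only: minus_minus)
  also have "\<dots> = - cycle_int f" unfolding cycle_int_def using assms by simp
  finally show ?thesis by linarith
qed

lemma cycle_int_linear:
  "continuous_on {-pi..pi} f \<Longrightarrow> continuous_on {-pi..pi} g \<Longrightarrow> cycle_int (\<lambda>\<phi>. f \<phi> + g \<phi>) = cycle_int f + cycle_int g"
  "continuous_on {-pi..pi} f \<Longrightarrow> continuous_on {-pi..pi} g \<Longrightarrow> cycle_int (\<lambda>\<phi>. f \<phi> - g \<phi>) = cycle_int f - cycle_int g"
  "cycle_int (\<lambda>\<phi>. c * f \<phi>) = c * cycle_int f"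
  unfolding cycle_int_def
    apply (rule Henstock_Kurzweil_Integration.integral_add; rule integrable_continuous_interval; assumption)
   apply (rule Henstock_Kurzweil_Integration.integral_diff; rule integrable_continuous_interval; assumption)
  apply (rule integral_mult_right)
  done

lemma param_periodic: "xpar s (-pi) = xpar s pi" "vpar s (-pi) = vpar s pi" "ypar s (-pi) = ypar s pi" "rpar s (-pi) = rpar s pi" "zpar s (-pi) = zpar s pi"
  by (simp_all add: xpar_def vpar_def ypar_def rpar_def zpar_def dxpar_def)

lemma param_reflect: "xpar s (-\<phi>) = 1 - xpar s \<phi>" "dxpar s (-\<phi>) = dxpar s \<phi>" "vpar s (-\<phi>) = vpar s \<phi>" "zpar s (-\<phi>) = zpar s \<phi>" "rpar s (-\<phi>) = rpar s \<phi>"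
  by (simp_all add: xpar_def vpar_def rpar_def zpar_def dxpar_def)

section \<open>Reduction of the integrals to three periods\<close>

text \<open>The integral of \<open>x ^ a * v ^ l * (2 * y) ^ j dx\<close> over the oval; \<open>a\<close> may be negative.\<close>
definition moment :: "int \<Rightarrow> nat \<Rightarrow> nat \<Rightarrow> real \<Rightarrow> real" where
  "moment a l j s = cycle_int (\<lambda>\<phi>. xpar s \<phi> powi a * vpar s \<phi> ^ l * (2 * ypar s \<phi>) ^ j * dxpar s \<phi>)"

text \<open>The integral of \<open>w(z) * v dx\<close> over the oval.\<close>
definition int_v :: "(real \<Rightarrow> real) \<Rightarrow> real \<Rightarrow> real" where
  "int_v w s = cycle_int (\<lambda>\<phi>. w (zpar s \<phi>) * vpar s \<phi> * dxpar s \<phi>)"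

lemma cycle_int_cong: "(\<And>\<phi>. f \<phi> = g \<phi>) \<Longrightarrow> cycle_int f = cycle_int g"
  by (rule arg_cong[where f = cycle_int], rule ext)

lemma cycle_int_sum:
  assumes "finite I" "\<And>i. i \<in> I \<Longrightarrow> continuous_on {-pi..pi} (f i)"
  shows "cycle_int (\<lambda>\<phi>. \<Sum>i\<in>I. f i \<phi>) = (\<Sum>i\<in>I. cycle_int (f i))"
  unfolding cycle_int_def using assms by (intro integral_sum integrable_continuous_interval) auto

context
  fixes s :: real
  assumes s: "0 < s" "s < 1/4"
begin

lemma xpar_nz: "xpar s \<phi> \<noteq> 0" using xpar_bounds(1)[OF s] by (metis less_irrefl)
lemma zpar_nz: "zpar s \<phi> \<noteq> 0" using zpar_pos[OF s] by (metis less_irrefl)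
lemma rpar_nz: "rpar s \<phi> \<noteq> 0" using rpar_pos[OF s] by (metis less_irrefl)

lemma powi_Suc: "xpar s \<phi> powi (a + 1) = xpar s \<phi> powi a * xpar s \<phi>"
  using xpar_nz by (simp add: power_int_add)

lemma moment_continuous:
  "continuous_on S (\<lambda>\<phi>. xpar s \<phi> powi a * vpar s \<phi> ^ l * (2 * ypar s \<phi>) ^ j * dxpar s \<phi>)"
  by (intro continuous_on_mult continuous_on_power continuous_on_power_int continuous_on_const
     param_continuous[OF s] ballI xpar_nz disjI2)

lemma xpar_powi_deriv:
  "((\<lambda>\<phi>. xpar s \<phi> powi a) has_real_derivative (of_int a * xpar s \<phi> powi (a - 1) * dxpar s \<phi>)) (at \<phi> within S)"
  by (rule DERIV_power_int[OF xpar_deriv[OF s]]) (simp add: xpar_nz)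

text \<open>Even powers of \<open>v\<close> are Laurent polynomials in \<open>x\<close>, whose integrals vanish; the power \<open>x powi (-1)\<close>
  causes no trouble since \<open>ln x\<close> is defined along the oval.\<close>
lemma moment_even_zero: "moment a 0 0 s = 0"
proof (cases "a = -1")
  case True
  have "((\<lambda>\<phi>. ln (xpar s \<phi>)) has_real_derivative xpar s \<phi> powi a * vpar s \<phi> ^ 0 * (2 * ypar s \<phi>) ^ 0 * dxpar s \<phi>)
      (at \<phi> within S)" for \<phi> S
    using xpar_bounds(1)[OF s, of \<phi>] True
    by (auto intro!: derivative_eq_intros xpar_deriv[OF s] simp: field_simps)
  then show ?thesis unfolding moment_def by (rule cycle_int_deriv_zero) (simp add: param_periodic)
next
  case False
  then have nz: "of_int (a + 1) \<noteq> (0::real)" by linarith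
  have "((\<lambda>\<phi>. xpar s \<phi> powi (a + 1) / of_int (a + 1)) has_real_derivative
     (of_int (a + 1) * xpar s \<phi> powi (a + 1 - 1) * dxpar s \<phi>) / of_int (a + 1)) (at \<phi> within S)" for \<phi> S
    by (intro DERIV_cdivide xpar_powi_deriv)
  then have "((\<lambda>\<phi>. xpar s \<phi> powi (a + 1) / of_int (a + 1)) has_real_derivative
     xpar s \<phi> powi a * vpar s \<phi> ^ 0 * (2 * ypar s \<phi>) ^ 0 * dxpar s \<phi>) (at \<phi> within S)" for \<phi> S
    using nz by (simp del: of_int_add)
  then show ?thesis unfolding moment_def by (rule cycle_int_deriv_zero) (simp add: param_periodic)
qed

lemma moment_reduce_v:
  "moment a (Suc (Suc l)) 0 s = moment (a + 2) l 0 s - 2 * moment (a + 3) l 0 s + moment (a + 4) l 0 s - s\<^sup>2 * moment a l 0 s"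
proof -
  let ?I = "\<lambda>a \<phi>. xpar s \<phi> powi a * vpar s \<phi> ^ l * (2 * ypar s \<phi>) ^ 0 * dxpar s \<phi>"
  have p: "xpar s \<phi> powi (a + 2) = xpar s \<phi> powi a * xpar s \<phi> ^ 2"
    "xpar s \<phi> powi (a + 3) = xpar s \<phi> powi a * xpar s \<phi> ^ 3"
    "xpar s \<phi> powi (a + 4) = xpar s \<phi> powi a * xpar s \<phi> ^ 4" for \<phi>
    using xpar_nz[of \<phi>] by (simp_all add: power_int_add)
  have "moment a (Suc (Suc l)) 0 s = cycle_int (\<lambda>\<phi>. ((?I (a+2) \<phi> - 2 * ?I (a+3) \<phi>) + ?I (a+4) \<phi>) - s\<^sup>2 * ?I a \<phi>)"
    unfolding moment_def
  proof (rule cycle_int_cong)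
    fix \<phi>
    have "vpar s \<phi> ^ Suc (Suc l) = vpar s \<phi> ^ l * ((xpar s \<phi> * (1 - xpar s \<phi>))\<^sup>2 - s\<^sup>2)"
      unfolding xpar_zpar[OF s] vpar_sq[OF s, symmetric] by (simp add: power2_eq_square)
    then show "xpar s \<phi> powi a * vpar s \<phi> ^ Suc (Suc l) * (2 * ypar s \<phi>) ^ 0 * dxpar s \<phi> =
        ((?I (a+2) \<phi> - 2 * ?I (a+3) \<phi>) + ?I (a+4) \<phi>) - s\<^sup>2 * ?I a \<phi>"
      unfolding p
      by (simp only:) (simp add: power2_eq_square power3_eq_cube power4_eq_xxxx algebra_simps)
  qed
  then show ?thesis
    unfolding moment_def by (simp only: cycle_int_linear continuous_on_add continuous_on_diff continuous_on_mult continuous_on_const moment_continuous)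
qed

lemma moment_reduce_y:
  "moment a l (Suc j) s = moment a l j s - moment (a + 1) l j s + moment (a - 1) (Suc l) j s"
proof -
  let ?I = "\<lambda>a l \<phi>. xpar s \<phi> powi a * vpar s \<phi> ^ l * (2 * ypar s \<phi>) ^ j * dxpar s \<phi>"
  have "moment a l (Suc j) s = cycle_int (\<lambda>\<phi>. ?I a l \<phi> - ?I (a + 1) l \<phi> + ?I (a - 1) (Suc l) \<phi>)"
    unfolding moment_def
  proof (rule cycle_int_cong)
    fix \<phi>
    have p: "xpar s \<phi> powi a = xpar s \<phi> powi (a - 1) * xpar s \<phi>" "xpar s \<phi> powi (a + 1) = xpar s \<phi> powi (a - 1) * xpar s \<phi> * xpar s \<phi>"
      using powi_Suc[of \<phi> "a - 1"] powi_Suc[of \<phi> a] by simp_all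
    have "xpar s \<phi> * (2 * ypar s \<phi>) = xpar s \<phi> * (1 - xpar s \<phi>) + vpar s \<phi>"
      using xpar_nz[of \<phi>] by (simp add: ypar_def field_simps)
    then show "xpar s \<phi> powi a * vpar s \<phi> ^ l * (2 * ypar s \<phi>) ^ Suc j * dxpar s \<phi>
       = ?I a l \<phi> - ?I (a + 1) l \<phi> + ?I (a - 1) (Suc l) \<phi>"
    proof -
      assume e: "xpar s \<phi> * (2 * ypar s \<phi>) = xpar s \<phi> * (1 - xpar s \<phi>) + vpar s \<phi>"
      have "xpar s \<phi> powi a * vpar s \<phi> ^ l * (2 * ypar s \<phi>) ^ Suc j * dxpar s \<phi>
        = xpar s \<phi> powi (a - 1) * vpar s \<phi> ^ l * (2 * ypar s \<phi>) ^ j * dxpar s \<phi> * (xpar s \<phi> * (2 * ypar s \<phi>))"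
        unfolding p power_Suc by (simp only: mult_ac)
      then show ?thesis unfolding e p power_Suc by (simp only:) (simp add: ring_distribs mult_ac)
    qed
  qed
  then show ?thesis
    unfolding moment_def by (simp only: cycle_int_linear continuous_on_add continuous_on_diff moment_continuous)
qed

text \<open>The integral of the exact form \<open>d (x ^ a * v ^ 3)\<close>, with \<open>v dv = z dz\<close> used to eliminate \<open>dv\<close>.\<close>
lemma moment_recurrence:
  "(of_int a + 3) * moment (a + 1) 1 0 s - (2 * of_int a + 9) * moment (a + 2) 1 0 s
    + (of_int a + 6) * moment (a + 3) 1 0 s - s\<^sup>2 * of_int a * moment (a - 1) 1 0 s = 0"
proof -
  let ?I = "\<lambda>a \<phi>. xpar s \<phi> powi a * vpar s \<phi> ^ 1 * (2 * ypar s \<phi>) ^ 0 * dxpar s \<phi>"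
  let ?f = "\<lambda>\<phi>. (of_int a + 3) * ?I (a + 1) \<phi> - (2 * of_int a + 9) * ?I (a + 2) \<phi>
    + (of_int a + 6) * ?I (a + 3) \<phi> - (s\<^sup>2 * of_int a) * ?I (a - 1) \<phi>"
  have "((\<lambda>\<phi>. xpar s \<phi> powi a * vpar s \<phi> ^ 3) has_real_derivative ?f \<phi>) (at \<phi> within S)" for \<phi> S
  proof (rule DERIV_cong)
    show "((\<lambda>\<phi>. xpar s \<phi> powi a * vpar s \<phi> ^ 3) has_real_derivative
       (of_int a * xpar s \<phi> powi (a - 1) * dxpar s \<phi>) * vpar s \<phi> ^ 3 + (of_nat 3 * (dvpar s \<phi> * vpar s \<phi> ^ (3 - Suc 0))) * xpar s \<phi> powi a) (at \<phi> within S)"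
      by (intro DERIV_mult DERIV_power xpar_powi_deriv vpar_deriv[OF s])
    have p: "xpar s \<phi> powi a = xpar s \<phi> powi (a - 1) * xpar s \<phi>"
      "xpar s \<phi> powi (a + 1) = xpar s \<phi> powi (a - 1) * xpar s \<phi> ^ 2"
      "xpar s \<phi> powi (a + 2) = xpar s \<phi> powi (a - 1) * xpar s \<phi> ^ 3"
      "xpar s \<phi> powi (a + 3) = xpar s \<phi> powi (a - 1) * xpar s \<phi> ^ 4"
      using power_int_add[of "xpar s \<phi>" "a - 1" 1] power_int_add[of "xpar s \<phi>" "a - 1" 2] power_int_add[of "xpar s \<phi>" "a - 1" 3]
        power_int_add[of "xpar s \<phi>" "a - 1" 4] xpar_nz[of \<phi>] by (simp_all add: add.commute)
    have v2: "vpar s \<phi> ^ 2 = (xpar s \<phi> * (1 - xpar s \<phi>))\<^sup>2 - s\<^sup>2"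
      unfolding xpar_zpar[OF s] vpar_sq[OF s] ..
    have w: "vpar s \<phi> * dvpar s \<phi> = - 2 * (xpar s \<phi> - 1/2) * dxpar s \<phi> * (xpar s \<phi> * (1 - xpar s \<phi>))"
      unfolding xpar_zpar[OF s] vpar_dvpar[OF s] ..
    have "of_int a * xpar s \<phi> powi (a - 1) * dxpar s \<phi> * vpar s \<phi> ^ 3 + of_nat 3 * (dvpar s \<phi> * vpar s \<phi> ^ (3 - Suc 0)) * xpar s \<phi> powi a
      = xpar s \<phi> powi (a - 1) * vpar s \<phi> * (of_int a * dxpar s \<phi> * vpar s \<phi> ^ 2 + 3 * xpar s \<phi> * (vpar s \<phi> * dvpar s \<phi>))"
      unfolding p by (simp add: power2_eq_square power3_eq_cube algebra_simps)
    also have "\<dots> = ?f \<phi>" unfolding v2 w p by (simp add: field_simps) algebra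
    finally show "of_int a * xpar s \<phi> powi (a - 1) * dxpar s \<phi> * vpar s \<phi> ^ 3 + of_nat 3 * (dvpar s \<phi> * vpar s \<phi> ^ (3 - Suc 0)) * xpar s \<phi> powi a = ?f \<phi>" .
  qed
  then have "cycle_int ?f = 0" by (rule cycle_int_deriv_zero) (simp add: param_periodic)
  then show ?thesis
    unfolding moment_def by (simp only: cycle_int_linear continuous_on_add continuous_on_diff continuous_on_mult continuous_on_const moment_continuous)
qed

text \<open>The four moments at which the recurrence stops. The parts that are odd under \<open>x \<mapsto> 1 - x\<close> drop out.\<close>
lemma moment_base:
  "moment 0 1 0 s = int_v (\<lambda>_. 1) s" "moment 1 1 0 s = int_v (\<lambda>_. 1) s / 2"
  "moment 2 1 0 s = int_v (\<lambda>_. 1) s / 2 - int_v (\<lambda>z. z) s"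
  "moment (-1) 1 0 s = int_v inverse s / 2"
proof -
  let ?b = "\<lambda>\<phi>. vpar s \<phi> * dxpar s \<phi>"
  let ?odd = "\<lambda>\<phi>. (xpar s \<phi> - 1/2) * ?b \<phi>"
  have odd: "cycle_int ?odd = 0" by (rule cycle_int_odd_zero) (simp add: param_reflect field_simps)
  have odd': "cycle_int (\<lambda>\<phi>. inverse (zpar s \<phi>) * ?odd \<phi>) = 0" by (rule cycle_int_odd_zero) (simp add: param_reflect algebra_simps)
  have c: "continuous_on {-pi..pi} ?b" "continuous_on {-pi..pi} ?odd"
    "continuous_on {-pi..pi} (\<lambda>\<phi>. zpar s \<phi> * ?b \<phi>)" "continuous_on {-pi..pi} (\<lambda>\<phi>. inverse (zpar s \<phi>) * ?b \<phi>)"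
    "continuous_on {-pi..pi} (\<lambda>\<phi>. inverse (zpar s \<phi>) * ?odd \<phi>)"
    by (intro continuous_on_mult continuous_on_diff continuous_on_inverse continuous_on_const param_continuous[OF s] ballI zpar_nz)+
  show 0: "moment 0 1 0 s = int_v (\<lambda>_. 1) s" unfolding moment_def int_v_def by simp
  have "moment 1 1 0 s = cycle_int (\<lambda>\<phi>. 1/2 * ?b \<phi> + ?odd \<phi>)"
    unfolding moment_def by (rule cycle_int_cong) (simp add: field_simps)
  also have "\<dots> = 1/2 * cycle_int ?b + cycle_int ?odd" by (simp only: cycle_int_linear c continuous_on_mult continuous_on_const)
  finally show "moment 1 1 0 s = int_v (\<lambda>_. 1) s / 2" using odd by (simp add: int_v_def)
  have "moment 2 1 0 s = cycle_int (\<lambda>\<phi>. 1/2 * ?b \<phi> - zpar s \<phi> * ?b \<phi> + ?odd \<phi>)"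
    unfolding moment_def
    by (rule cycle_int_cong) (simp add: xpar_zpar[OF s, symmetric] power2_eq_square algebra_simps)
  also have "\<dots> = 1/2 * cycle_int ?b - cycle_int (\<lambda>\<phi>. zpar s \<phi> * ?b \<phi>) + cycle_int ?odd"
    by (simp only: cycle_int_linear c continuous_on_mult continuous_on_diff continuous_on_const)
  finally show "moment 2 1 0 s = int_v (\<lambda>_. 1) s / 2 - int_v (\<lambda>z. z) s"
    using odd by (simp add: int_v_def mult.assoc)
  have "moment (-1) 1 0 s = cycle_int (\<lambda>\<phi>. 1/2 * (inverse (zpar s \<phi>) * ?b \<phi>) - inverse (zpar s \<phi>) * ?odd \<phi>)"
    unfolding moment_def
  proof (rule cycle_int_cong)
    fix \<phi>
    have "xpar s \<phi> powi (-1) = inverse (zpar s \<phi>) * (1 - xpar s \<phi>)"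
      unfolding xpar_zpar[OF s, symmetric] using xpar_nz[of \<phi>] xpar_bounds(2)[OF s, of \<phi>] by (simp add: field_simps)
    then show "xpar s \<phi> powi (-1) * vpar s \<phi> ^ 1 * (2 * ypar s \<phi>) ^ 0 * dxpar s \<phi> =
      1/2 * (inverse (zpar s \<phi>) * ?b \<phi>) - inverse (zpar s \<phi>) * ?odd \<phi>"
      by (simp only:) (simp add: algebra_simps)
  qed
  also have "\<dots> = 1/2 * cycle_int (\<lambda>\<phi>. inverse (zpar s \<phi>) * ?b \<phi>) - cycle_int (\<lambda>\<phi>. inverse (zpar s \<phi>) * ?odd \<phi>)"
    by (simp only: cycle_int_linear c continuous_on_mult continuous_on_const)
  finally show "moment (-1) 1 0 s = int_v inverse s / 2" using odd' by (simp add: int_v_def mult.assoc)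
qed

end

text \<open>The functions of \<open>s\<close> that are combinations of the three periods with coefficients polynomial in
  \<open>t = s\<^sup>2 / 4\<close> of degree at most \<open>n / 4\<close>.\<close>
definition petrov_module :: "nat \<Rightarrow> (real \<Rightarrow> real) \<Rightarrow> bool" where
  "petrov_module n f \<longleftrightarrow> (\<exists>\<alpha> \<beta> \<gamma>. 4 * degree \<alpha> \<le> n \<and> 4 * degree \<beta> \<le> n \<and> 4 * degree \<gamma> \<le> n \<and>
     (\<forall>s. 0 < s \<longrightarrow> s < 1/4 \<longrightarrow> f s = poly \<gamma> (s\<^sup>2/4) * int_v inverse s
        + poly \<alpha> (s\<^sup>2/4) * int_v (\<lambda>_. 1) s + poly \<beta> (s\<^sup>2/4) * int_v (\<lambda>z. z) s))"

lemma petrov_module_cong: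
  assumes "petrov_module n g" "\<And>s. 0 < s \<Longrightarrow> s < 1/4 \<Longrightarrow> f s = g s"
  shows "petrov_module n f"
  using assms unfolding petrov_module_def by metis

lemma petrov_module_zero: "petrov_module n (\<lambda>s. 0)"
  unfolding petrov_module_def by (intro exI[of _ "0::real poly"]) simp

lemma petrov_module_add:
  assumes "petrov_module n f" "petrov_module n g"
  shows "petrov_module n (\<lambda>s. f s + g s)"
proof -
  obtain \<alpha> \<beta> \<gamma> where 1: "4 * degree \<alpha> \<le> n" "4 * degree \<beta> \<le> n" "4 * degree \<gamma> \<le> n"
     "\<And>s. 0 < s \<Longrightarrow> s < 1/4 \<Longrightarrow> f s = poly \<gamma> (s\<^sup>2/4) * int_v inverse s
        + poly \<alpha> (s\<^sup>2/4) * int_v (\<lambda>_. 1) s + poly \<beta> (s\<^sup>2/4) * int_v (\<lambda>z. z) s"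
    using assms(1) unfolding petrov_module_def by blast
  obtain \<alpha>' \<beta>' \<gamma>' where 2: "4 * degree \<alpha>' \<le> n" "4 * degree \<beta>' \<le> n" "4 * degree \<gamma>' \<le> n"
     "\<And>s. 0 < s \<Longrightarrow> s < 1/4 \<Longrightarrow> g s = poly \<gamma>' (s\<^sup>2/4) * int_v inverse s
        + poly \<alpha>' (s\<^sup>2/4) * int_v (\<lambda>_. 1) s + poly \<beta>' (s\<^sup>2/4) * int_v (\<lambda>z. z) s"
    using assms(2) unfolding petrov_module_def by blast
  show ?thesis unfolding petrov_module_def
    using 1 2 degree_add_le_max[of \<alpha> \<alpha>'] degree_add_le_max[of \<beta> \<beta>'] degree_add_le_max[of \<gamma> \<gamma>']
    by (intro exI[of _ "\<alpha> + \<alpha>'"] exI[of _ "\<beta> + \<beta>'"] exI[of _ "\<gamma> + \<gamma>'"]) (auto simp: algebra_simps)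
qed

lemma petrov_module_scale:
  assumes "petrov_module n f"
  shows "petrov_module n (\<lambda>s. c * f s)"
proof -
  obtain \<alpha> \<beta> \<gamma> where 1: "4 * degree \<alpha> \<le> n" "4 * degree \<beta> \<le> n" "4 * degree \<gamma> \<le> n"
     "\<And>s. 0 < s \<Longrightarrow> s < 1/4 \<Longrightarrow> f s = poly \<gamma> (s\<^sup>2/4) * int_v inverse s
        + poly \<alpha> (s\<^sup>2/4) * int_v (\<lambda>_. 1) s + poly \<beta> (s\<^sup>2/4) * int_v (\<lambda>z. z) s"
    using assms(1) unfolding petrov_module_def by blast
  show ?thesis unfolding petrov_module_def
    using 1 degree_smult_le[of c \<alpha>] degree_smult_le[of c \<beta>] degree_smult_le[of c \<gamma>]
    by (intro exI[of _ "smult c \<alpha>"] exI[of _ "smult c \<beta>"] exI[of _ "smult c \<gamma>"]) (auto simp: algebra_simps)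
qed

lemma petrov_module_sum:
  assumes "finite I" "\<And>i. i \<in> I \<Longrightarrow> petrov_module n (f i)"
  shows "petrov_module n (\<lambda>s. \<Sum>i\<in>I. f i s)"
  using assms by (induction I rule: finite_induct) (auto intro: petrov_module_zero petrov_module_add)

lemma petrov_module_basis:
  assumes "4 * e \<le> n" "w = inverse \<or> w = (\<lambda>_. 1) \<or> w = (\<lambda>z. z)"
  shows "petrov_module n (\<lambda>s. (s\<^sup>2/4) ^ e * int_v w s)"
  using assms(2)
proof (elim disjE)
  assume w: "w = inverse"
  show ?thesis unfolding petrov_module_def w
    apply (rule exI[of _ "0::real poly"], rule exI[of _ "0::real poly"], rule exI[of _ "monom 1 e"])
    using assms(1) by (auto simp: poly_monom degree_monom_eq)
next
  assume w: "w = (\<lambda>_. 1)"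
  show ?thesis unfolding petrov_module_def w
    apply (rule exI[of _ "monom 1 e"], rule exI[of _ "0::real poly"], rule exI[of _ "0::real poly"])
    using assms(1) by (auto simp: poly_monom degree_monom_eq)
next
  assume w: "w = (\<lambda>z. z)"
  show ?thesis unfolding petrov_module_def w
    apply (rule exI[of _ "0::real poly"], rule exI[of _ "monom 1 e"], rule exI[of _ "0::real poly"])
    using assms(1) by (auto simp: poly_monom degree_monom_eq)
qed

lemma petrov_module_comb3:
  assumes "petrov_module n f" "petrov_module n g" "petrov_module n h"
    "\<And>s. 0 < s \<Longrightarrow> s < 1/4 \<Longrightarrow> F s = a * f s + b * g s + c * h s"
  shows "petrov_module n F"
  by (rule petrov_module_cong[OF petrov_module_add[OF petrov_module_add[OF petrov_module_scale petrov_module_scale] petrov_module_scale]])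
    (use assms in auto)

text \<open>Give \<open>x\<close>, \<open>v\<close>, \<open>t\<close> the weights \<open>1\<close>, \<open>2\<close>, \<open>4\<close>. The second hypothesis bounds the weight. The first one
  provides one factor \<open>t\<close> for every two negative powers of \<open>x\<close>: lowering a negative exponent by the recurrence
  divides by \<open>t\<close>, and this factor pays for it.\<close>
lemma petrov_module_moment_1:
  "0 \<le> 2 * int e + 1 + a \<Longrightarrow> 4 * int e + a + 1 \<le> int n \<Longrightarrow> petrov_module n (\<lambda>s. (s\<^sup>2/4) ^ e * moment a 1 0 s)"
proof (induction "nat \<bar>2 * a - 1\<bar>" arbitrary: a e rule: less_induct)
  case less
  \<comment> \<open>The measure \<open>\<bar>2 * a - 1\<bar>\<close> is symmetric about \<open>1/2\<close>, the centre of the base cases \<open>-1, 0, 1, 2\<close>.\<close>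
  note IH = less.hyps and prems = less.prems
  consider "a = -1" | "a = 0" | "a = 1" | "a = 2" | "a \<ge> 3" | "a \<le> -2" by linarith
  then show ?case
  proof cases
    assume a: "a = -1"
    have "petrov_module n (\<lambda>s. 1/2 * ((s\<^sup>2/4) ^ e * int_v inverse s))"
      using prems a by (intro petrov_module_scale petrov_module_basis) auto
    then show ?thesis by (rule petrov_module_cong) (simp add: a moment_base[unfolded One_nat_def])
  next
    assume a: "a = 0"
    have "petrov_module n (\<lambda>s. 1 * ((s\<^sup>2/4) ^ e * int_v (\<lambda>_. 1) s))"
      using prems a by (intro petrov_module_scale petrov_module_basis) auto
    then show ?thesis by (rule petrov_module_cong) (simp add: a moment_base[unfolded One_nat_def])
  next
    assume a: "a = 1"
    have "petrov_module n (\<lambda>s. 1/2 * ((s\<^sup>2/4) ^ e * int_v (\<lambda>_. 1) s))"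
      using prems a by (intro petrov_module_scale petrov_module_basis) auto
    then show ?thesis by (rule petrov_module_cong) (simp add: a moment_base[unfolded One_nat_def])
  next
    assume a: "a = 2"
    have "petrov_module n (\<lambda>s. 1/2 * ((s\<^sup>2/4) ^ e * int_v (\<lambda>_. 1) s) + (-1) * ((s\<^sup>2/4) ^ e * int_v (\<lambda>z. z) s))"
      using prems a by (intro petrov_module_add petrov_module_scale petrov_module_basis) auto
    then show ?thesis by (rule petrov_module_cong) (simp add: a moment_base[unfolded One_nat_def] algebra_simps)
  next
    assume a: "a \<ge> 3"
    define b where "b = a - 3"
    have b: "b \<ge> 0" "a = b + 3" using a by (auto simp: b_def)
    have "petrov_module n (\<lambda>s. (s\<^sup>2/4) ^ e * moment (b + 1) 1 0 s)"
      "petrov_module n (\<lambda>s. (s\<^sup>2/4) ^ e * moment (b + 2) 1 0 s)"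
      "petrov_module n (\<lambda>s. (s\<^sup>2/4) ^ Suc e * moment (b - 1) 1 0 s)"
      using prems b by (intro IH; simp)+
    then show ?thesis
    proof (rule petrov_module_comb3)
      fix s :: real assume s: "0 < s" "s < 1/4"
      define B where "B = real_of_int b"
      have B: "B + 6 \<noteq> 0" using b unfolding B_def by linarith
      have "(B + 6) * moment (b + 3) 1 0 s = - (B + 3) * moment (b + 1) 1 0 s + (2 * B + 9) * moment (b + 2) 1 0 s + s\<^sup>2 * B * moment (b - 1) 1 0 s"
        using moment_recurrence[OF s, of b] unfolding B_def by (simp add: algebra_simps)
      then have "moment (b + 3) 1 0 s = (- (B + 3) * moment (b + 1) 1 0 s + (2 * B + 9) * moment (b + 2) 1 0 s + s\<^sup>2 * B * moment (b - 1) 1 0 s) / (B + 6)"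
        using B by (simp add: field_simps)
      moreover have "T * ((p * m1 + q * m2 + s2 * B * m3) / D) =
        (p / D) * (T * m1) + (q / D) * (T * m2) + (4 * B / D) * ((s2/4) * T * m3)"
        for T m1 m2 m3 p q s2 D :: real by (simp add: add_divide_distrib ring_distribs mult_ac)
      ultimately show "(s\<^sup>2/4) ^ e * moment a 1 0 s = (- (B + 3) / (B + 6)) * ((s\<^sup>2/4) ^ e * moment (b + 1) 1 0 s)
         + ((2 * B + 9) / (B + 6)) * ((s\<^sup>2/4) ^ e * moment (b + 2) 1 0 s) + (4 * B / (B + 6)) * ((s\<^sup>2/4) ^ Suc e * moment (b - 1) 1 0 s)"
        unfolding b(2) power_Suc by (simp only:)
    qed
  next
    assume a: "a \<le> -2"
    define b where "b = a + 1"
    have b: "b \<le> -1" "a = b - 1" using a by (auto simp: b_def)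
    obtain e' where e: "e = Suc e'" using prems(1) a by (cases e) auto
    have "petrov_module n (\<lambda>s. (s\<^sup>2/4) ^ e' * moment (b + 1) 1 0 s)"
      "petrov_module n (\<lambda>s. (s\<^sup>2/4) ^ e' * moment (b + 2) 1 0 s)"
      "petrov_module n (\<lambda>s. (s\<^sup>2/4) ^ e' * moment (b + 3) 1 0 s)"
      using prems b e by (intro IH; simp)+
    then show ?thesis
    proof (rule petrov_module_comb3)
      fix s :: real assume s: "0 < s" "s < 1/4"
      define B where "B = real_of_int b"
      have B: "B \<noteq> 0" using b unfolding B_def by linarith
      have "s\<^sup>2 * B * moment (b - 1) 1 0 s = (B + 3) * moment (b + 1) 1 0 s - (2 * B + 9) * moment (b + 2) 1 0 s + (B + 6) * moment (b + 3) 1 0 s"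
        using moment_recurrence[OF s, of b] unfolding B_def by (simp add: algebra_simps)
      then have m: "(s\<^sup>2/4) * moment (b - 1) 1 0 s = ((B + 3) * moment (b + 1) 1 0 s - (2 * B + 9) * moment (b + 2) 1 0 s + (B + 6) * moment (b + 3) 1 0 s) / (4 * B)"
        using B by (simp add: field_simps)
      have "(s\<^sup>2/4) ^ e * moment a 1 0 s = (s\<^sup>2/4) ^ e' * ((s\<^sup>2/4) * moment (b - 1) 1 0 s)"
        unfolding e b(2) power_Suc by (simp only: mult.commute mult.left_commute mult.assoc)
      then show "(s\<^sup>2/4) ^ e * moment a 1 0 s = ((B + 3) / (4 * B)) * ((s\<^sup>2/4) ^ e' * moment (b + 1) 1 0 s)
         + (- (2 * B + 9) / (4 * B)) * ((s\<^sup>2/4) ^ e' * moment (b + 2) 1 0 s) + ((B + 6) / (4 * B)) * ((s\<^sup>2/4) ^ e' * moment (b + 3) 1 0 s)"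
        unfolding m by (simp only:) (simp add: add_divide_distrib diff_divide_distrib algebra_simps)
    qed
  qed
qed

text \<open>Each substitution \<open>v\<^sup>2 = x\<^sup>2 * (1 - x)\<^sup>2 - 4 * t\<close> preserves both hypotheses.\<close>
lemma petrov_module_moment_0:
  "0 \<le> int l + 2 * int e + a \<Longrightarrow> 4 * int e + a + 2 * int l - 1 \<le> int n \<Longrightarrow> petrov_module n (\<lambda>s. (s\<^sup>2/4) ^ e * moment a l 0 s)"
proof (induction l arbitrary: a e rule: less_induct)
  case (less l)
  note IH = less.IH and prems = less.prems
  consider "l = 0" | "l = 1" | k where "l = Suc (Suc k)" by (metis One_nat_def not0_implies_Suc)
  then show ?case
  proof cases
    assume "l = 0"
    then show ?thesis by (intro petrov_module_cong[OF petrov_module_zero]) (simp add: moment_even_zero)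
  next
    assume "l = 1"
    then show ?thesis using prems petrov_module_moment_1[of e a n] by simp
  next
    fix k assume l: "l = Suc (Suc k)"
    have "petrov_module n (\<lambda>s. 1 * ((s\<^sup>2/4) ^ e * moment (a + 2) k 0 s) + (-2) * ((s\<^sup>2/4) ^ e * moment (a + 3) k 0 s)
       + (1 * ((s\<^sup>2/4) ^ e * moment (a + 4) k 0 s) + (-4) * ((s\<^sup>2/4) ^ Suc e * moment a k 0 s)))"
      using prems l by (intro petrov_module_add petrov_module_scale IH) auto
    then show ?thesis
      by (rule petrov_module_cong) (simp add: l moment_reduce_v algebra_simps)
  qed
qed

lemma petrov_module_moment:
  "0 \<le> int l + a \<Longrightarrow> a + 2 * int l + int j \<le> int n + 1 \<Longrightarrow> petrov_module n (moment a l j)"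
proof (induction j arbitrary: a l)
  case 0
  then show ?case using petrov_module_moment_0[of l 0 a n] by simp
next
  case (Suc j)
  have "petrov_module n (moment a l j)" "petrov_module n (moment (a + 1) l j)" "petrov_module n (moment (a - 1) (Suc l) j)"
    using Suc.prems by (intro Suc.IH; simp)+
  then show ?case
    by (rule petrov_module_comb3[where a=1 and b="-1" and c=1]) (simp add: moment_reduce_y)
qed

lemma eval2_sum:
  "eval2 P (x, y) = (\<Sum>j\<le>degree P. \<Sum>i\<le>degree (coeff P j). coeff (coeff P j) i * (x ^ i * y ^ j))"
  by (simp add: eval2_def poly_altdef[of P] poly_sum poly_altdef[of "coeff P _"] sum_distrib_right mult.assoc)

lemma le_total_degree:
  assumes "coeff (coeff P j) i \<noteq> 0"
  shows "i + j \<le> total_degree P"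
  unfolding total_degree_def using assms finite_total_degree_set[of P] by (intro Max_ge) auto

text \<open>The integral of \<open>p dx + q dy\<close> over the parametrized oval.\<close>
definition form_int :: "real poly poly \<Rightarrow> real poly poly \<Rightarrow> real \<Rightarrow> real" where
  "form_int p q s = cycle_int (\<lambda>\<phi>. eval2 p (xpar s \<phi>, ypar s \<phi>) * dxpar s \<phi> + eval2 q (xpar s \<phi>, ypar s \<phi>) * dypar s \<phi>)"

context
  fixes s :: real
  assumes s: "0 < s" "s < 1/4"
begin

lemma cycle_int_monomial_dx: "cycle_int (\<lambda>\<phi>. (xpar s \<phi> ^ i * ypar s \<phi> ^ j) * dxpar s \<phi>) = (1/2) ^ j * moment (int i) 0 j s"
proof -
  have "moment (int i) 0 j s = cycle_int (\<lambda>\<phi>. 2 ^ j * ((xpar s \<phi> ^ i * ypar s \<phi> ^ j) * dxpar s \<phi>))"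
    unfolding moment_def by (rule cycle_int_cong) (simp add: power_mult_distrib)
  then show ?thesis by (simp add: cycle_int_linear power_divide)
qed

text \<open>Integration by parts. For \<open>i = 0\<close> the truncated exponent \<open>i - 1\<close> is harmless, as its coefficient
  vanishes.\<close>
lemma cycle_int_monomial_dy:
  "cycle_int (\<lambda>\<phi>. (xpar s \<phi> ^ i * ypar s \<phi> ^ j) * dypar s \<phi>) =
     - (real i / real (Suc j)) * cycle_int (\<lambda>\<phi>. (xpar s \<phi> ^ (i - 1) * ypar s \<phi> ^ Suc j) * dxpar s \<phi>)"
proof -
  have c: "continuous_on {-pi..pi} (\<lambda>\<phi>. (xpar s \<phi> ^ a * ypar s \<phi> ^ b) * dxpar s \<phi>)"
     "continuous_on {-pi..pi} (\<lambda>\<phi>. (xpar s \<phi> ^ a * ypar s \<phi> ^ b) * dypar s \<phi>)" for a b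
    by (intro continuous_on_mult continuous_on_power param_continuous[OF s] dypar_continuous[OF s])+
  have "((\<lambda>\<phi>. xpar s \<phi> ^ i * ypar s \<phi> ^ Suc j) has_real_derivative
     (real i * ((xpar s \<phi> ^ (i - 1) * ypar s \<phi> ^ Suc j) * dxpar s \<phi>) + real (Suc j) * ((xpar s \<phi> ^ i * ypar s \<phi> ^ j) * dypar s \<phi>))) (at \<phi> within S)" for \<phi> S
  proof (rule DERIV_cong)
    show "((\<lambda>\<phi>. xpar s \<phi> ^ i * ypar s \<phi> ^ Suc j) has_real_derivative
      (of_nat i * (dxpar s \<phi> * xpar s \<phi> ^ (i - Suc 0))) * ypar s \<phi> ^ Suc j +
      (of_nat (Suc j) * (dypar s \<phi> * ypar s \<phi> ^ (Suc j - Suc 0))) * xpar s \<phi> ^ i) (at \<phi> within S)"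
      by (intro DERIV_mult DERIV_power xpar_deriv[OF s] ypar_deriv[OF s])
  qed (simp add: algebra_simps)
  then have "cycle_int (\<lambda>\<phi>. real i * ((xpar s \<phi> ^ (i - 1) * ypar s \<phi> ^ Suc j) * dxpar s \<phi>) + real (Suc j) * ((xpar s \<phi> ^ i * ypar s \<phi> ^ j) * dypar s \<phi>)) = 0"
    by (rule cycle_int_deriv_zero) (simp add: param_periodic)
  then have "real i * cycle_int (\<lambda>\<phi>. (xpar s \<phi> ^ (i - 1) * ypar s \<phi> ^ Suc j) * dxpar s \<phi>) + real (Suc j) * cycle_int (\<lambda>\<phi>. (xpar s \<phi> ^ i * ypar s \<phi> ^ j) * dypar s \<phi>) = 0"
    by (simp only: cycle_int_linear c continuous_on_mult continuous_on_const)
  then show ?thesis by (simp add: field_simps del: of_nat_Suc)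
qed

lemma cycle_int_eval2:
  assumes g: "continuous_on {-pi..pi} g"
  shows "cycle_int (\<lambda>\<phi>. eval2 P (xpar s \<phi>, ypar s \<phi>) * g \<phi>) =
    (\<Sum>j\<le>degree P. \<Sum>i\<le>degree (coeff P j). coeff (coeff P j) i * cycle_int (\<lambda>\<phi>. (xpar s \<phi> ^ i * ypar s \<phi> ^ j) * g \<phi>))"
proof -
  have c: "continuous_on {-pi..pi} (\<lambda>\<phi>. coeff (coeff P j) i * ((xpar s \<phi> ^ i * ypar s \<phi> ^ j) * g \<phi>))" for i j
    by (intro continuous_on_mult continuous_on_power continuous_on_const param_continuous[OF s] g)
  have "cycle_int (\<lambda>\<phi>. eval2 P (xpar s \<phi>, ypar s \<phi>) * g \<phi>)
     = cycle_int (\<lambda>\<phi>. \<Sum>j\<le>degree P. \<Sum>i\<le>degree (coeff P j). coeff (coeff P j) i * ((xpar s \<phi> ^ i * ypar s \<phi> ^ j) * g \<phi>))"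
    by (rule cycle_int_cong) (simp only: eval2_sum sum_distrib_right mult.assoc)
  also have "\<dots> = (\<Sum>j\<le>degree P. cycle_int (\<lambda>\<phi>. \<Sum>i\<le>degree (coeff P j). coeff (coeff P j) i * ((xpar s \<phi> ^ i * ypar s \<phi> ^ j) * g \<phi>)))"
    by (rule cycle_int_sum) (auto intro!: continuous_on_sum c)
  also have "\<dots> = (\<Sum>j\<le>degree P. \<Sum>i\<le>degree (coeff P j). cycle_int (\<lambda>\<phi>. coeff (coeff P j) i * ((xpar s \<phi> ^ i * ypar s \<phi> ^ j) * g \<phi>)))"
    by (rule sum.cong[OF refl], rule cycle_int_sum) (auto intro!: c)
  finally show ?thesis by (simp only: cycle_int_linear(3))
qed

lemma eval2_continuous: "continuous_on S (\<lambda>\<phi>. eval2 P (xpar s \<phi>, ypar s \<phi>))"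
  unfolding eval2_sum
  by (intro continuous_on_sum continuous_on_mult continuous_on_power continuous_on_const param_continuous[OF s])

lemma form_int_split:
  "form_int p q s = cycle_int (\<lambda>\<phi>. eval2 p (xpar s \<phi>, ypar s \<phi>) * dxpar s \<phi>) + cycle_int (\<lambda>\<phi>. eval2 q (xpar s \<phi>, ypar s \<phi>) * dypar s \<phi>)"
  unfolding form_int_def
  by (intro cycle_int_linear continuous_on_mult eval2_continuous param_continuous[OF s] dypar_continuous[OF s])

end

lemma petrov_module_monomial_dx:
  assumes "i + j \<le> n" shows "petrov_module n (\<lambda>s. cycle_int (\<lambda>\<phi>. (xpar s \<phi> ^ i * ypar s \<phi> ^ j) * dxpar s \<phi>))"
proof -
  have "petrov_module n (\<lambda>s. (1/2) ^ j * moment (int i) 0 j s)"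
    using assms by (intro petrov_module_scale petrov_module_moment) auto
  then show ?thesis by (rule petrov_module_cong) (rule cycle_int_monomial_dx)
qed

lemma petrov_module_monomial_dy:
  assumes "i + j \<le> n" shows "petrov_module n (\<lambda>s. cycle_int (\<lambda>\<phi>. (xpar s \<phi> ^ i * ypar s \<phi> ^ j) * dypar s \<phi>))"
proof (cases "i = 0")
  case True
  then show ?thesis by (intro petrov_module_cong[OF petrov_module_zero]) (simp add: cycle_int_monomial_dy[of _ 0, simplified])
next
  case False
  then have "petrov_module n (\<lambda>s. - (real i / real (Suc j)) * cycle_int (\<lambda>\<phi>. (xpar s \<phi> ^ (i - 1) * ypar s \<phi> ^ Suc j) * dxpar s \<phi>))"
    using assms by (intro petrov_module_scale petrov_module_monomial_dx) auto
  then show ?thesis by (rule petrov_module_cong) (rule cycle_int_monomial_dy)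
qed

lemma petrov_module_double_sum:
  assumes "total_degree P \<le> n" "\<And>i j. i + j \<le> n \<Longrightarrow> petrov_module n (f i j)"
  shows "petrov_module n (\<lambda>s. \<Sum>j\<le>degree P. \<Sum>i\<le>degree (coeff P j). coeff (coeff P j) i * f i j s)"
proof (intro petrov_module_sum finite_atMost)
  fix i j
  show "petrov_module n (\<lambda>s. coeff (coeff P j) i * f i j s)"
  proof (cases "coeff (coeff P j) i = 0")
    case True
    then show ?thesis by (simp add: petrov_module_zero)
  next
    case False
    then show ?thesis using le_total_degree[OF False] assms by (intro petrov_module_scale) auto
  qed
qed

theorem petrov_module_form_int: "petrov_module (form_degree p q) (form_int p q)"
proof -
  have "petrov_module (form_degree p q) (\<lambda>s.
      (\<Sum>j\<le>degree p. \<Sum>i\<le>degree (coeff p j). coeff (coeff p j) i * cycle_int (\<lambda>\<phi>. (xpar s \<phi> ^ i * ypar s \<phi> ^ j) * dxpar s \<phi>)) +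
      (\<Sum>j\<le>degree q. \<Sum>i\<le>degree (coeff q j). coeff (coeff q j) i * cycle_int (\<lambda>\<phi>. (xpar s \<phi> ^ i * ypar s \<phi> ^ j) * dypar s \<phi>)))"
    by (intro petrov_module_add petrov_module_double_sum petrov_module_monomial_dx petrov_module_monomial_dy)
      (auto simp: form_degree_def)
  then show ?thesis
    by (rule petrov_module_cong) (simp only: form_int_split cycle_int_eval2 param_continuous dypar_continuous)
qed

section \<open>The differential equations of the periods\<close>

text \<open>The integral of \<open>w(z) / v dx\<close> over the oval, written with \<open>dx / v = d\<phi> / rpar\<close>, which is regular also
  where \<open>v = 0\<close>.\<close>
definition int_inv_v :: "(real \<Rightarrow> real) \<Rightarrow> real \<Rightarrow> real" where
  "int_inv_v w s = cycle_int (\<lambda>\<phi>. w (zpar s \<phi>) / rpar s \<phi>)"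

lemma int_v_alt:
  assumes s: "0 < s" "s < 1/4"
  shows "int_v w s = cycle_int (\<lambda>\<phi>. w (zpar s \<phi>) * ((1/4 - s) * (cos \<phi>)\<^sup>2 * rpar s \<phi>))"
  unfolding int_v_def
proof (rule cycle_int_cong)
  fix \<phi>
  have "vpar s \<phi> * dxpar s \<phi> = (sqrt (1/4 - s) * sqrt (1/4 - s)) * (cos \<phi>)\<^sup>2 * rpar s \<phi>"
    by (simp add: vpar_def dxpar_def power2_eq_square)
  then show "w (zpar s \<phi>) * vpar s \<phi> * dxpar s \<phi> = w (zpar s \<phi>) * ((1/4 - s) * (cos \<phi>)\<^sup>2 * rpar s \<phi>)"
    unfolding amp_sq[OF s] by (simp add: mult.assoc)
qed

lemma vpar_dxpar:
  assumes s: "0 < s" "s < 1/4"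
  shows "vpar s \<phi> * dxpar s \<phi> = ((zpar s \<phi>)\<^sup>2 - s\<^sup>2) / rpar s \<phi>"
proof -
  have "vpar s \<phi> * dxpar s \<phi> * rpar s \<phi> = (dxpar s \<phi> * dxpar s \<phi>) * (rpar s \<phi> * rpar s \<phi>)" by (simp add: vpar_def)
  also have "\<dots> = (zpar s \<phi>)\<^sup>2 - s\<^sup>2" unfolding dxpar_sq[OF s] rpar_sq[OF s] by (simp add: power2_eq_square algebra_simps)
  finally show ?thesis using rpar_nz[OF s, of \<phi>] by (simp add: field_simps)
qed

text \<open>Differentiating \<open>v\<^sup>2 = z\<^sup>2 - s\<^sup>2\<close> at fixed \<open>x\<close> gives \<open>- s / v\<close>. At fixed angle the integrand
  changes by the additional term \<open>- 1/2 * d (w(z) * sin \<phi> * cos \<phi> * rpar)\<close>, which integrates to zero.\<close>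
lemma int_v_deriv:
  fixes w w' :: "real \<Rightarrow> real"
  assumes w: "\<And>z. z > 0 \<Longrightarrow> (w has_real_derivative w' z) (at z)" and w': "continuous_on {0<..} w'"
    and s: "0 < s" "s < 1/4"
  shows "(int_v w has_real_derivative - s * int_inv_v w s) (at s)"
proof -
  let ?U = "{0<..<1/4::real}"
  define f where "f = (\<lambda>s \<phi>. w (zpar s \<phi>) * ((1/4 - s) * (cos \<phi>)\<^sup>2 * rpar s \<phi>))"
  define fx where "fx = (\<lambda>s \<phi>. w' (zpar s \<phi>) * (sin \<phi>)\<^sup>2 * ((1/4 - s) * (cos \<phi>)\<^sup>2 * rpar s \<phi>) +
     w (zpar s \<phi>) * (- (cos \<phi>)\<^sup>2 * rpar s \<phi> + (1/4 - s) * (cos \<phi>)\<^sup>2 * (((sin \<phi>)\<^sup>2 + 1) / (2 * rpar s \<phi>))))"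
  have w_cont: "continuous_on {0<..} w"
    using w by (intro DERIV_continuous_on) (auto intro: has_field_derivative_at_within)
  have zpar_cont: "continuous_on (?U \<times> cbox (-pi) pi) (\<lambda>x. zpar (fst x) (snd x))"
    unfolding zpar_def by (intro continuous_intros) auto
  have rpar_cont: "continuous_on (?U \<times> cbox (-pi) pi) (\<lambda>x. rpar (fst x) (snd x))"
    unfolding rpar_def by (intro continuous_on_real_sqrt continuous_on_add zpar_cont continuous_on_fst continuous_on_id)
  have "((\<lambda>s. integral (cbox (-pi) pi) (f s)) has_field_derivative integral (cbox (-pi) pi) (fx s)) (at s within ?U)"
  proof (rule leibniz_rule_field_derivative)
    fix s \<phi> assume s': "s \<in> ?U"
    then have s: "0 < s" "s < 1/4" by auto
    have z: "((\<lambda>s. zpar s \<phi>) has_real_derivative (sin \<phi>)\<^sup>2) (at s within ?U)"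
      unfolding zpar_def by (auto intro!: derivative_eq_intros)
    have p: "zpar s \<phi> + s > 0" using zpar_pos[OF s, of \<phi>] s by simp
    have d: "((\<lambda>s. rpar s \<phi>) has_real_derivative (((sin \<phi>)\<^sup>2 + 1) / (2 * rpar s \<phi>))) (at s within ?U)"
      unfolding rpar_def using p by (auto intro!: derivative_eq_intros z simp: field_simps)
    have wz: "((\<lambda>s. w (zpar s \<phi>)) has_real_derivative w' (zpar s \<phi>) * (sin \<phi>)\<^sup>2) (at s within ?U)"
      by (rule DERIV_chain2[OF w z]) (rule zpar_pos[OF s])
    have k: "((\<lambda>s. (1/4 - s) * (cos \<phi>)\<^sup>2) has_real_derivative - (cos \<phi>)\<^sup>2) (at s within ?U)"
      by (auto intro!: derivative_eq_intros)
    show "((\<lambda>s. f s \<phi>) has_field_derivative fx s \<phi>) (at s within ?U)"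
      unfolding f_def by (rule DERIV_cong[OF DERIV_mult[OF wz DERIV_mult[OF k d]]]) (simp add: fx_def algebra_simps)
  next
    fix s assume "s \<in> ?U"
    then have s: "0 < s" "s < 1/4" by auto
    have "continuous_on {-pi..pi} (\<lambda>\<phi>. w (zpar s \<phi>))"
      by (rule continuous_on_compose2[OF w_cont param_continuous(3)[OF s]]) (auto simp: zpar_pos[OF s])
    then have "continuous_on {-pi..pi} (f s)" unfolding f_def
      by (intro continuous_on_mult continuous_on_power continuous_on_const continuous_on_cos continuous_on_id param_continuous[OF s])
    then show "f s integrable_on cbox (-pi) pi"
      by (simp add: integrable_continuous_interval)
  next
    have zp: "(\<lambda>x. zpar (fst x) (snd x)) ` (?U \<times> cbox (-pi) pi) \<subseteq> {0<..}"
      by (auto intro: zpar_pos)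
    have dn: "\<forall>x\<in>?U \<times> cbox (-pi) pi. 2 * rpar (fst x) (snd x) \<noteq> 0"
      using rpar_nz by auto
    have "continuous_on (?U \<times> cbox (-pi) pi) (\<lambda>x. fx (fst x) (snd x))"
      unfolding fx_def
      by (intro continuous_on_add continuous_on_mult continuous_on_divide continuous_on_minus continuous_on_power continuous_on_diff
        continuous_on_const continuous_on_cos continuous_on_sin continuous_on_fst continuous_on_snd continuous_on_id rpar_cont dn
        continuous_on_compose2[OF w_cont zpar_cont zp] continuous_on_compose2[OF w' zpar_cont zp])
    then show "continuous_on (?U \<times> cbox (-pi) pi) (\<lambda>(s, \<phi>). fx s \<phi>)" by (simp add: case_prod_unfold)
  qed (use s in auto)
  then have "((\<lambda>s. cycle_int (f s)) has_real_derivative cycle_int (fx s)) (at s within ?U)"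
    by (simp add: cycle_int_def)
  then have 1: "((\<lambda>s. cycle_int (f s)) has_real_derivative cycle_int (fx s)) (at s)"
    using s by (subst (asm) at_within_open) auto
  have 2: "cycle_int (fx s) = - s * int_inv_v w s"
  proof -
    define g where "g = (\<lambda>\<phi>. (w' (zpar s \<phi>) * (- 2 * (xpar s \<phi> - 1/2) * dxpar s \<phi>)) * (sin \<phi> * cos \<phi> * rpar s \<phi>) +
       w (zpar s \<phi>) * (((cos \<phi>)\<^sup>2 - (sin \<phi>)\<^sup>2) * rpar s \<phi> + sin \<phi> * cos \<phi> * (- (xpar s \<phi> - 1/2) * dxpar s \<phi> / rpar s \<phi>)))"
    have gd: "((\<lambda>\<phi>. w (zpar s \<phi>) * (sin \<phi> * cos \<phi> * rpar s \<phi>)) has_real_derivative g \<phi>) (at \<phi> within S)" for \<phi> S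
    proof -
      have sc: "((\<lambda>\<phi>. sin \<phi> * cos \<phi>) has_real_derivative ((cos \<phi>)\<^sup>2 - (sin \<phi>)\<^sup>2)) (at \<phi> within S)"
        by (auto intro!: derivative_eq_intros simp: power2_eq_square)
      have wz: "((\<lambda>\<phi>. w (zpar s \<phi>)) has_real_derivative w' (zpar s \<phi>) * (- 2 * (xpar s \<phi> - 1/2) * dxpar s \<phi>)) (at \<phi> within S)"
        by (rule DERIV_chain2[OF w zpar_deriv[OF s]]) (rule zpar_pos[OF s])
      show ?thesis unfolding g_def
        by (rule DERIV_cong[OF DERIV_mult[OF wz DERIV_mult[OF sc rpar_deriv[OF s]]]]) (simp add: algebra_simps)
    qed
    then have g0: "cycle_int g = 0" by (rule cycle_int_deriv_zero) (simp add: param_periodic)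
    have wc: "continuous_on {-pi..pi} (\<lambda>\<phi>. w (zpar s \<phi>))" "continuous_on {-pi..pi} (\<lambda>\<phi>. w' (zpar s \<phi>))"
      using zpar_pos[OF s] by (auto intro!: continuous_on_compose2[OF w_cont param_continuous(3)[OF s]] continuous_on_compose2[OF w' param_continuous(3)[OF s]])
    have gc: "continuous_on {-pi..pi} g" unfolding g_def
      by (intro continuous_on_add continuous_on_mult continuous_on_divide continuous_on_minus continuous_on_power continuous_on_diff
        continuous_on_const continuous_on_cos continuous_on_sin continuous_on_id wc param_continuous[OF s] ballI rpar_nz[OF s])
    have ac: "continuous_on {-pi..pi} (\<lambda>\<phi>. w (zpar s \<phi>) / rpar s \<phi>)"
      by (intro continuous_on_divide wc param_continuous[OF s] ballI rpar_nz[OF s])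
    have "cycle_int (fx s) = cycle_int (\<lambda>\<phi>. (- s) * (w (zpar s \<phi>) / rpar s \<phi>) - 1/2 * g \<phi>)"
    proof (rule cycle_int_cong)
      fix \<phi>
      let ?S = "sin \<phi>" and ?C = "cos \<phi>" and ?D = "rpar s \<phi>" and ?W = "w (zpar s \<phi>)" and ?W' = "w' (zpar s \<phi>)"
      have ux: "(xpar s \<phi> - 1/2) * dxpar s \<phi> = (1/4 - s) * ?S * ?C"
      proof -
        have "(xpar s \<phi> - 1/2) * dxpar s \<phi> = (sqrt (1/4 - s) * sqrt (1/4 - s)) * ?S * ?C" by (simp add: xpar_def dxpar_def)
        then show ?thesis unfolding amp_sq[OF s] .
      qed
      have D2: "?D * ?D = (1/4 - s) * ?C\<^sup>2 + 2 * s"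
        unfolding rpar_sq[OF s] zpar_def sin_squared_eq by (simp add: algebra_simps)
      have S2: "?S\<^sup>2 = 1 - ?C\<^sup>2" by (rule sin_squared_eq)
      have core: "- ?C\<^sup>2 * ?D + (1/4 - s) * ?C\<^sup>2 * ((?S\<^sup>2 + 1) / (2 * ?D)) =
         - s / ?D - 1/2 * ((?C\<^sup>2 - ?S\<^sup>2) * ?D + ?S * ?C * (- (xpar s \<phi> - 1/2) * dxpar s \<phi> / ?D))" (is "?l = ?r")
      proof -
        have "?l * (2 * ?D) = - 2 * ?C\<^sup>2 * (?D * ?D) + (1/4 - s) * ?C\<^sup>2 * (?S\<^sup>2 + 1)"
          using rpar_nz[OF s, of \<phi>] by (simp add: field_simps)
        moreover have "?r * (2 * ?D) = - 2 * s - (?C\<^sup>2 - ?S\<^sup>2) * (?D * ?D) + ?S * ?C * ((xpar s \<phi> - 1/2) * dxpar s \<phi>)"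
          using rpar_nz[OF s, of \<phi>] by (simp add: field_simps)
        moreover have "?S * ?C * ((1/4 - s) * ?S * ?C) = (1/4 - s) * ?S\<^sup>2 * ?C\<^sup>2"
          by (simp add: power2_eq_square)
        moreover have "- 2 * c * ((1/4 - s) * c + 2 * s) + (1/4 - s) * c * (1 - c + 1) =
            - 2 * s - (c - (1 - c)) * ((1/4 - s) * c + 2 * s) + (1/4 - s) * (1 - c) * c" for c
          by (simp add: field_simps)
        ultimately have "?l * (2 * ?D) = ?r * (2 * ?D)" unfolding D2 ux S2 by simp
        then show ?thesis using rpar_nz[OF s, of \<phi>] by simp
      qed
      have "fx s \<phi> = ?W' * ?S\<^sup>2 * ((1/4 - s) * ?C\<^sup>2 * ?D) + ?W * (- s / ?D - 1/2 * ((?C\<^sup>2 - ?S\<^sup>2) * ?D + ?S * ?C * (- (xpar s \<phi> - 1/2) * dxpar s \<phi> / ?D)))"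
        unfolding fx_def core ..
      also have "?W' * ?S\<^sup>2 * ((1/4 - s) * ?C\<^sup>2 * ?D) = - 1/2 * ((?W' * (- 2 * ((xpar s \<phi> - 1/2) * dxpar s \<phi>))) * (?S * ?C * ?D))"
        unfolding ux power2_eq_square by (simp add: field_simps)
      finally show "fx s \<phi> = (- s) * (?W / ?D) - 1/2 * g \<phi>"
        unfolding g_def mult.assoc[of "- 2"] by (simp add: algebra_simps)
    qed
    also have "\<dots> = (- s) * int_inv_v w s - 1/2 * cycle_int g"
      unfolding int_inv_v_def by (simp only: cycle_int_linear continuous_on_mult continuous_on_const gc ac)
    finally show ?thesis using g0 by simp
  qed
  show ?thesis
  proof (rule has_field_derivative_transform_within_open)
    show "((\<lambda>s. cycle_int (f s)) has_real_derivative - s * int_inv_v w s) (at s)" using 1 2 by simp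
    show "open ?U" "s \<in> ?U" using s by auto
    show "cycle_int (f t) = int_v w t" if "t \<in> ?U" for t using int_v_alt[of t w] that by (simp add: f_def)
  qed
qed

context
  fixes s :: real
  assumes s: "0 < s" "s < 1/4"
begin

lemma int_inv_v_int_continuous:
  assumes "continuous_on {0<..} w"
  shows "continuous_on {-pi..pi} (\<lambda>\<phi>. w (zpar s \<phi>) / rpar s \<phi>)"
  using zpar_pos[OF s]
  by (intro continuous_on_divide continuous_on_compose2[OF assms param_continuous(3)[OF s]] param_continuous[OF s] ballI rpar_nz[OF s]) auto

lemma int_inv_v_pos: "int_inv_v (\<lambda>_. 1) s > 0"
proof -
  let ?f = "\<lambda>\<phi>. 1 / rpar s \<phi>"
  have c: "continuous_on {-pi..pi} ?f"
    by (intro continuous_on_divide continuous_on_const param_continuous[OF s] ballI rpar_nz[OF s])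
  have p: "?f \<phi> > 0" for \<phi> using rpar_pos[OF s, of \<phi>] by simp
  have "cycle_int ?f \<ge> 0" unfolding cycle_int_def using p by (intro integral_nonneg integrable_continuous_interval c) (auto intro: less_imp_le)
  moreover have "cycle_int ?f \<noteq> 0"
  proof
    assume "cycle_int ?f = 0"
    then have "(?f has_integral 0) (cbox (-pi) pi)"
      using integrable_integral[OF integrable_continuous_interval[OF c]] by (simp add: cycle_int_def)
    then have "?f 0 = 0"
      using c p pi_gt_zero by (intro has_integral_0_cbox_imp_0[of "-pi" pi ?f]) (auto intro: less_imp_le simp del: pi_gt_zero)
    then show False using p[of 0] by simp
  qed
  ultimately show ?thesis by (simp add: int_inv_v_def)
qed

lemma int_v_inverse_int_inv_v: "int_v inverse s = int_inv_v (\<lambda>z. z) s - s\<^sup>2 * int_inv_v inverse s"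
proof -
  have "int_v inverse s = cycle_int (\<lambda>\<phi>. zpar s \<phi> / rpar s \<phi> - s\<^sup>2 * (inverse (zpar s \<phi>) / rpar s \<phi>))"
    unfolding int_v_def
    by (rule cycle_int_cong, subst mult.assoc, subst vpar_dxpar[OF s])
      (use zpar_nz[OF s] rpar_nz[OF s] in \<open>simp add: field_simps power2_eq_square\<close>)
  also have "\<dots> = int_inv_v (\<lambda>z. z) s - s\<^sup>2 * int_inv_v inverse s"
  proof -
    have "continuous_on {-pi..pi} (\<lambda>\<phi>. zpar s \<phi> / rpar s \<phi>)" "continuous_on {-pi..pi} (\<lambda>\<phi>. inverse (zpar s \<phi>) / rpar s \<phi>)"
      by (intro continuous_on_divide continuous_on_inverse param_continuous[OF s] ballI rpar_nz[OF s] zpar_nz[OF s])+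
    then show ?thesis unfolding int_inv_v_def by (simp only: cycle_int_linear continuous_on_mult continuous_on_const)
  qed
  finally show ?thesis .
qed

text \<open>The exact forms \<open>d ((x - 1/2) * v)\<close> and \<open>d (z * (x - 1/2) * v)\<close> express the integrals of \<open>z\<^sup>2 / v\<close> and
  \<open>z ^ 3 / v\<close> by those of \<open>1 / v\<close> and \<open>z / v\<close>.\<close>
lemma uv_deriv:
  "((\<lambda>\<phi>. (xpar s \<phi> - 1/2) * vpar s \<phi>) has_real_derivative
     (3 * (zpar s \<phi>)\<^sup>2 - zpar s \<phi> / 2 - s\<^sup>2) / rpar s \<phi>) (at \<phi> within S)"
proof (rule DERIV_cong)
  show "((\<lambda>\<phi>. (xpar s \<phi> - 1/2) * vpar s \<phi>) has_real_derivative (dxpar s \<phi> - 0) * vpar s \<phi> + dvpar s \<phi> * (xpar s \<phi> - 1/2)) (at \<phi> within S)"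
    by (intro DERIV_mult DERIV_diff DERIV_const xpar_deriv[OF s] vpar_deriv[OF s])
  have u2: "(xpar s \<phi> - 1/2) * (xpar s \<phi> - 1/2) = 1/4 - zpar s \<phi>"
    unfolding xpar_zpar[OF s, symmetric] by (simp add: field_simps)
  have "(dxpar s \<phi> - 0) * vpar s \<phi> + dvpar s \<phi> * (xpar s \<phi> - 1/2) = vpar s \<phi> * dxpar s \<phi> + dvpar s \<phi> * (xpar s \<phi> - 1/2)" by simp
  also have "\<dots> = ((zpar s \<phi>)\<^sup>2 - s\<^sup>2) / rpar s \<phi> - 2 * zpar s \<phi> * ((xpar s \<phi> - 1/2) * (xpar s \<phi> - 1/2)) / rpar s \<phi>"
    unfolding vpar_dxpar[OF s] dvpar_alt[OF s] using rpar_nz[OF s, of \<phi>] by (simp add: field_simps)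
  also have "\<dots> = (3 * (zpar s \<phi>)\<^sup>2 - zpar s \<phi> / 2 - s\<^sup>2) / rpar s \<phi>"
    unfolding u2 using rpar_nz[OF s, of \<phi>] by (simp add: field_simps power2_eq_square)
  finally show "(dxpar s \<phi> - 0) * vpar s \<phi> + dvpar s \<phi> * (xpar s \<phi> - 1/2) = (3 * (zpar s \<phi>)\<^sup>2 - zpar s \<phi> / 2 - s\<^sup>2) / rpar s \<phi>" .
qed

lemma uzv_deriv:
  "((\<lambda>\<phi>. zpar s \<phi> * ((xpar s \<phi> - 1/2) * vpar s \<phi>)) has_real_derivative
     (5 * (zpar s \<phi>) ^ 3 - (zpar s \<phi>)\<^sup>2 - 3 * s\<^sup>2 * zpar s \<phi> + s\<^sup>2 / 2) / rpar s \<phi>) (at \<phi> within S)"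
proof (rule DERIV_cong[OF DERIV_mult[OF zpar_deriv[OF s] uv_deriv]])
  have u2: "(xpar s \<phi> - 1/2) * (xpar s \<phi> - 1/2) = 1/4 - zpar s \<phi>"
    unfolding xpar_zpar[OF s, symmetric] by (simp add: field_simps)
  have "- 2 * (xpar s \<phi> - 1/2) * dxpar s \<phi> * ((xpar s \<phi> - 1/2) * vpar s \<phi>) = - 2 * ((xpar s \<phi> - 1/2) * (xpar s \<phi> - 1/2)) * (vpar s \<phi> * dxpar s \<phi>)"
    by (simp only: mult_ac)
  also have "\<dots> = - 2 * (1/4 - zpar s \<phi>) * ((zpar s \<phi>)\<^sup>2 - s\<^sup>2) / rpar s \<phi>" unfolding u2 vpar_dxpar[OF s] by simp
  finally show "- 2 * (xpar s \<phi> - 1/2) * dxpar s \<phi> * ((xpar s \<phi> - 1/2) * vpar s \<phi>) + (3 * (zpar s \<phi>)\<^sup>2 - zpar s \<phi> / 2 - s\<^sup>2) / rpar s \<phi> * zpar s \<phi>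
     = (5 * (zpar s \<phi>) ^ 3 - (zpar s \<phi>)\<^sup>2 - 3 * s\<^sup>2 * zpar s \<phi> + s\<^sup>2 / 2) / rpar s \<phi>"
    by (simp only:) (use rpar_nz[OF s, of \<phi>] in \<open>simp add: field_simps power2_eq_square power3_eq_cube\<close>)
qed

lemma int_v_int_inv_v:
  "int_v (\<lambda>_. 1) s = int_inv_v (\<lambda>z. z) s / 6 - 2/3 * s\<^sup>2 * int_inv_v (\<lambda>_. 1) s"
  "int_v (\<lambda>z. z) s = (1/30 - 2/5 * s\<^sup>2) * int_inv_v (\<lambda>z. z) s - 1/30 * s\<^sup>2 * int_inv_v (\<lambda>_. 1) s"
proof -
  let ?a = "\<lambda>k \<phi>. zpar s \<phi> ^ k / rpar s \<phi>"
  let ?A = "\<lambda>k. cycle_int (?a k)"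
  have c: "continuous_on {-pi..pi} (?a k)" for k
    by (rule int_inv_v_int_continuous) (intro continuous_intros)
  have A: "int_inv_v (\<lambda>z. z) s = ?A 1" "int_inv_v (\<lambda>_. 1) s = ?A 0" by (simp_all add: int_inv_v_def)
  have B: "int_v (\<lambda>_. 1) s = ?A 2 - s\<^sup>2 * ?A 0" "int_v (\<lambda>z. z) s = ?A 3 - s\<^sup>2 * ?A 1"
  proof -
    have "int_v (\<lambda>_. 1) s = cycle_int (\<lambda>\<phi>. ?a 2 \<phi> - s\<^sup>2 * ?a 0 \<phi>)"
      unfolding int_v_def by (rule cycle_int_cong) (simp add: vpar_dxpar[OF s] diff_divide_distrib)
    then show "int_v (\<lambda>_. 1) s = ?A 2 - s\<^sup>2 * ?A 0" by (simp only: cycle_int_linear c continuous_on_mult continuous_on_const)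
    have "int_v (\<lambda>z. z) s = cycle_int (\<lambda>\<phi>. ?a 3 \<phi> - s\<^sup>2 * ?a 1 \<phi>)"
      unfolding int_v_def by (rule cycle_int_cong, subst mult.assoc, subst vpar_dxpar[OF s]) (simp add: diff_divide_distrib right_diff_distrib power3_eq_cube power2_eq_square mult_ac)
    then show "int_v (\<lambda>z. z) s = ?A 3 - s\<^sup>2 * ?A 1" by (simp only: cycle_int_linear c continuous_on_mult continuous_on_const)
  qed
  have "cycle_int (\<lambda>\<phi>. (3 * (zpar s \<phi>)\<^sup>2 - zpar s \<phi> / 2 - s\<^sup>2) / rpar s \<phi>) = 0"
    by (rule cycle_int_deriv_zero[OF uv_deriv]) (simp add: param_periodic)
  moreover have "cycle_int (\<lambda>\<phi>. (3 * (zpar s \<phi>)\<^sup>2 - zpar s \<phi> / 2 - s\<^sup>2) / rpar s \<phi>) = cycle_int (\<lambda>\<phi>. 3 * ?a 2 \<phi> - 1/2 * ?a 1 \<phi> - s\<^sup>2 * ?a 0 \<phi>)"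
    by (rule cycle_int_cong) (simp add: diff_divide_distrib)
  ultimately have 1: "3 * ?A 2 - 1/2 * ?A 1 - s\<^sup>2 * ?A 0 = 0"
    by (simp only: cycle_int_linear c continuous_on_mult continuous_on_const continuous_on_diff)
  have "cycle_int (\<lambda>\<phi>. (5 * (zpar s \<phi>) ^ 3 - (zpar s \<phi>)\<^sup>2 - 3 * s\<^sup>2 * zpar s \<phi> + s\<^sup>2 / 2) / rpar s \<phi>) = 0"
    by (rule cycle_int_deriv_zero[OF uzv_deriv]) (simp add: param_periodic)
  moreover have "cycle_int (\<lambda>\<phi>. (5 * (zpar s \<phi>) ^ 3 - (zpar s \<phi>)\<^sup>2 - 3 * s\<^sup>2 * zpar s \<phi> + s\<^sup>2 / 2) / rpar s \<phi>) = cycle_int (\<lambda>\<phi>. 5 * ?a 3 \<phi> - ?a 2 \<phi> - (3 * s\<^sup>2) * ?a 1 \<phi> + (s\<^sup>2/2) * ?a 0 \<phi>)"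
    by (rule cycle_int_cong) (simp add: diff_divide_distrib add_divide_distrib)
  ultimately have 2: "5 * ?A 3 - ?A 2 - (3 * s\<^sup>2) * ?A 1 + (s\<^sup>2/2) * ?A 0 = 0"
    by (simp only: cycle_int_linear c continuous_on_mult continuous_on_const continuous_on_diff continuous_on_add)
  from 1 have A2: "?A 2 = ?A 1 / 6 + s\<^sup>2 / 3 * ?A 0" by (simp add: field_simps)
  from 2 have A3: "?A 3 = (?A 2 + (3 * s\<^sup>2) * ?A 1 - (s\<^sup>2/2) * ?A 0) / 5" by (simp add: field_simps)
  show "int_v (\<lambda>_. 1) s = int_inv_v (\<lambda>z. z) s / 6 - 2/3 * s\<^sup>2 * int_inv_v (\<lambda>_. 1) s"
    unfolding A B A2 by (simp add: field_simps)
  show "int_v (\<lambda>z. z) s = (1/30 - 2/5 * s\<^sup>2) * int_inv_v (\<lambda>z. z) s - 1/30 * s\<^sup>2 * int_inv_v (\<lambda>_. 1) s"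
    unfolding A B A3 A2 by (simp add: field_simps)
qed

end

text \<open>The periods as functions of \<open>t = s\<^sup>2 / 4\<close>: the integrals of \<open>1 / v\<close>, \<open>z / v\<close>, \<open>v\<close>, \<open>z * v\<close> and \<open>v / z\<close>.\<close>
definition per_A0 where "per_A0 t = int_inv_v (\<lambda>_. 1) (2 * sqrt t)"
definition per_A1 where "per_A1 t = int_inv_v (\<lambda>z. z) (2 * sqrt t)"
definition per_B0 where "per_B0 t = int_v (\<lambda>_. 1) (2 * sqrt t)"
definition per_B1 where "per_B1 t = int_v (\<lambda>z. z) (2 * sqrt t)"
definition per_K where "per_K t = int_v inverse (2 * sqrt t)"

context
  fixes t :: real
  assumes t: "0 < t" "t < 1/64"
begin

lemma s_bounds: "0 < 2 * sqrt t" "2 * sqrt t < 1/4"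
proof -
  have "sqrt t < sqrt ((1/8)\<^sup>2)" using t by (subst real_sqrt_less_iff) (simp add: power2_eq_square)
  then show "0 < 2 * sqrt t" "2 * sqrt t < 1/4" using t by simp_all
qed

lemma int_v_sqrt_deriv:
  assumes "\<And>z. z > 0 \<Longrightarrow> (w has_real_derivative w' z) (at z)" "continuous_on {0<..} w'"
  shows "((\<lambda>t. int_v w (2 * sqrt t)) has_real_derivative - 2 * int_inv_v w (2 * sqrt t)) (at t)"
proof (rule DERIV_cong)
  have B: "(int_v w has_real_derivative - (2 * sqrt t) * int_inv_v w (2 * sqrt t)) (at (2 * sqrt t))"
    using assms s_bounds by (intro int_v_deriv)
  have "((\<lambda>t. 2 * sqrt t) has_real_derivative 1 / sqrt t) (at t)"
    using t by (auto intro!: derivative_eq_intros simp: divide_simps)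
  then show "((\<lambda>t. int_v w (2 * sqrt t)) has_real_derivative (- (2 * sqrt t) * int_inv_v w (2 * sqrt t)) * (1 / sqrt t)) (at t)"
    by (intro DERIV_chain2[of "int_v w" _ "\<lambda>t. 2 * sqrt t", OF B])
qed (use t in simp)

lemma per_B0_deriv: "(per_B0 has_real_derivative - 2 * per_A0 t) (at t)"
  using int_v_sqrt_deriv[of "\<lambda>_. 1" "\<lambda>_. 0"] by (simp add: per_B0_def[abs_def] per_A0_def)

lemma per_B1_deriv: "(per_B1 has_real_derivative - 2 * per_A1 t) (at t)"
  using int_v_sqrt_deriv[of "\<lambda>z. z" "\<lambda>_. 1"] by (simp add: per_B1_def[abs_def] per_A1_def)

text \<open>Equivalently, the derivative of \<open>per_K / sqrt t\<close> is \<open>- per_A1 / (2 * t * sqrt t)\<close>, and the integral of the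
  third kind disappears. This rests on \<open>v / z = z / v - s\<^sup>2 / (z * v)\<close>.\<close>
lemma per_K_deriv: "(per_K has_real_derivative (per_K t - per_A1 t) / (2 * t)) (at t)"
proof (rule DERIV_cong)
  show "(per_K has_real_derivative - 2 * int_inv_v inverse (2 * sqrt t)) (at t)"
    unfolding per_K_def[abs_def]
  proof (rule int_v_sqrt_deriv)
    show "(inverse has_real_derivative - (inverse z ^ Suc (Suc 0))) (at z)" if "z > 0" for z :: real
      using that by (intro DERIV_inverse) simp
    show "continuous_on {0<..} (\<lambda>z::real. - (inverse z ^ Suc (Suc 0)))"
      by (intro continuous_on_minus continuous_on_power continuous_on_inverse continuous_on_id) auto
  qed
  show "- 2 * int_inv_v inverse (2 * sqrt t) = (per_K t - per_A1 t) / (2 * t)"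
    unfolding per_K_def per_A1_def int_v_inverse_int_inv_v[OF s_bounds] using t by (simp add: field_simps)
qed

lemma per_A0_pos: "per_A0 t > 0" unfolding per_A0_def by (rule int_inv_v_pos[OF s_bounds])

lemma per_B_per_A:
  "per_B0 t = per_A1 t / 6 - 8/3 * t * per_A0 t"
  "per_B1 t = (1/30 - 8/5 * t) * per_A1 t - 2/15 * t * per_A0 t"
  unfolding per_B0_def per_B1_def per_A0_def per_A1_def int_v_int_inv_v[OF s_bounds] using t by (simp_all add: power_mult_distrib)

lemma per_A0_solve: "per_A0 t = (5 * per_B1 t - (1 - 48 * t) * per_B0 t) / (2 * t * (1 - 64 * t))"
  unfolding per_B_per_A using t by (simp add: field_simps)

end

lemma per_A0_deriv:
  assumes t: "0 < t" "t < 1/64"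
  shows "(per_A0 has_real_derivative (16 * t * per_A0 t - per_A1 t) / (t * (1 - 64 * t))) (at t)"
proof -
  let ?f = "\<lambda>t. (5 * per_B1 t - (1 - 48 * t) * per_B0 t) / (2 * t * (1 - 64 * t))"
  let ?n = "5 * per_B1 t - (1 - 48 * t) * per_B0 t" and ?n' = "5 * (- 2 * per_A1 t) - ((- 48) * per_B0 t + (- 2 * per_A0 t) * (1 - 48 * t))"
  have nz: "2 * t * (1 - 64 * t) \<noteq> 0" using t by simp
  have n: "((\<lambda>t. 5 * per_B1 t - (1 - 48 * t) * per_B0 t) has_real_derivative ?n') (at t)"
    by (rule DERIV_diff[OF DERIV_cmult[OF per_B1_deriv[OF t]] DERIV_mult[OF _ per_B0_deriv[OF t]]]) (auto intro!: derivative_eq_intros)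
  have d: "((\<lambda>t. 2 * t * (1 - 64 * t)) has_real_derivative (2 - 256 * t)) (at t)"
    by (auto intro!: derivative_eq_intros simp: algebra_simps)
  have "(?f has_real_derivative (?n' * (2 * t * (1 - 64 * t)) - ?n * (2 - 256 * t)) / ((2 * t * (1 - 64 * t)) * (2 * t * (1 - 64 * t)))) (at t)"
    by (rule DERIV_divide[OF n d nz])
  moreover have "(?n' * (2 * t * (1 - 64 * t)) - ?n * (2 - 256 * t)) / ((2 * t * (1 - 64 * t)) * (2 * t * (1 - 64 * t)))
     = (16 * t * per_A0 t - per_A1 t) / (t * (1 - 64 * t))"
  proof -
    have "?n = per_A0 t * (2 * t * (1 - 64 * t))" using per_A0_solve[OF t] nz by (simp add: field_simps)
    then have "(?n' * (2 * t * (1 - 64 * t)) - ?n * (2 - 256 * t)) / ((2 * t * (1 - 64 * t)) * (2 * t * (1 - 64 * t)))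
      = (?n' - per_A0 t * (2 - 256 * t)) / (2 * t * (1 - 64 * t))"
      using nz by (simp only:) (simp add: divide_simps, simp add: algebra_simps)
    also have "?n' - per_A0 t * (2 - 256 * t) = 2 * (16 * t * per_A0 t - per_A1 t)"
      unfolding per_B_per_A[OF t] by (simp add: field_simps)
    also have "\<dots> / (2 * t * (1 - 64 * t)) = (16 * t * per_A0 t - per_A1 t) / (t * (1 - 64 * t))"
      unfolding mult.assoc[of 2] by (rule mult_divide_mult_cancel_left) simp
    finally show ?thesis .
  qed
  ultimately have "(?f has_real_derivative (16 * t * per_A0 t - per_A1 t) / (t * (1 - 64 * t))) (at t)" by simp
  then show ?thesis
    by (rule has_field_derivative_transform_within_open[of _ _ _ "{0<..<1/64}"]) (use t per_A0_solve in auto)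
qed

lemma per_A1_deriv:
  assumes t: "0 < t" "t < 1/64"
  shows "(per_A1 has_real_derivative (4 * per_A0 t - 16 * per_A1 t) / (1 - 64 * t)) (at t)"
proof -
  have "((\<lambda>t. 6 * per_B0 t + 16 * t * per_A0 t) has_real_derivative
      6 * (- 2 * per_A0 t) + (16 * per_A0 t + (16 * t * per_A0 t - per_A1 t) / (t * (1 - 64 * t)) * (16 * t))) (at t)"
    by (intro DERIV_add DERIV_cmult per_B0_deriv[OF t] DERIV_mult per_A0_deriv[OF t]) (auto intro!: derivative_eq_intros)
  moreover have "6 * (- 2 * per_A0 t) + (16 * per_A0 t + (16 * t * per_A0 t - per_A1 t) / (t * (1 - 64 * t)) * (16 * t))
      = (4 * per_A0 t - 16 * per_A1 t) / (1 - 64 * t)"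
    using t by (simp add: field_simps)
  ultimately have "((\<lambda>t. 6 * per_B0 t + 16 * t * per_A0 t) has_real_derivative (4 * per_A0 t - 16 * per_A1 t) / (1 - 64 * t)) (at t)" by simp
  then show ?thesis
    by (rule has_field_derivative_transform_within_open[of _ _ _ "{0<..<1/64}"]) (use t per_B_per_A in auto)
qed

section \<open>Rolle's theorem for linear and Riccati equations\<close>

text \<open>The number of points of \<open>E\<close> to the left of a point is injective on \<open>Z\<close>.\<close>
lemma card_le_of_separated:
  fixes Z E :: "real set"
  assumes E: "finite E" and sep: "\<And>x y. x \<in> Z \<Longrightarrow> y \<in> Z \<Longrightarrow> x < y \<Longrightarrow> \<exists>e\<in>E. x < e \<and> e < y"
  shows "finite Z \<and> card Z \<le> card E + 1"
proof -
  define f where "f = (\<lambda>x. card {e \<in> E. e < x})"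
  have less: "f x < f y" if xy: "x \<in> Z" "y \<in> Z" "x < y" for x y
  proof -
    obtain e where e: "e \<in> E" "x < e" "e < y" using sep[OF xy] by blast
    have "e \<in> {e \<in> E. e < y}" "e \<notin> {e \<in> E. e < x}" using e by auto
    moreover have "{e \<in> E. e < x} \<subseteq> {e \<in> E. e < y}" using xy by auto
    ultimately have "{e \<in> E. e < x} \<subset> {e \<in> E. e < y}" by blast
    then show ?thesis unfolding f_def using E by (intro psubset_card_mono) auto
  qed
  have inj: "inj_on f Z"
    by (rule linorder_inj_onI) (use less in \<open>auto dest: less_imp_neq\<close>)
  have ran: "f ` Z \<subseteq> {..card E}" unfolding f_def using E by (auto intro: card_mono)
  have "finite Z" by (rule inj_on_finite[OF inj ran]) simp
  moreover have "card Z \<le> card {..card E}" by (rule card_inj_on_le[OF inj ran]) simp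
  ultimately show ?thesis by simp
qed

lemma interval_avoids:
  fixes x y u :: real
  assumes "x \<notin> E" "y \<notin> E" "\<not> (\<exists>e\<in>E. x < e \<and> e < y)" "u \<in> {x..y}"
  shows "u \<notin> E"
  using assms by (metis atLeastAtMost_iff order_le_less)

lemma card_split_le: "card T \<le> card (T - E) + card (T \<inter> E)"
  by (metis Un_Diff_Int card_Un_le)

lemma integrating_factor:
  fixes c :: "real \<Rightarrow> real"
  assumes "continuous_on {x..y} c"
  obtains C where "\<And>u. u \<in> {x..y} \<Longrightarrow> (C has_real_derivative c u) (at u within {x..y})"
proof
  fix u assume "u \<in> {x..y}"
  then show "((\<lambda>u. integral {x..u} c) has_real_derivative c u) (at u within {x..y})"
    using assms by (rule integral_has_real_derivative[rotated])
qed

text \<open>Rolle's theorem for \<open>h\<close> times the integrating factor of \<open>h' = c * h\<close>.\<close>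
lemma rolle_linear_ode:
  fixes h c R :: "real \<Rightarrow> real"
  assumes xy: "x < y" and h: "\<And>u. u \<in> {x..y} \<Longrightarrow> (h has_real_derivative c u * h u + R u) (at u)"
    and c: "continuous_on {x..y} c" and "h x = 0" "h y = 0"
  shows "\<exists>u. x < u \<and> u < y \<and> R u = 0"
proof -
  obtain C where C: "\<And>u. u \<in> {x..y} \<Longrightarrow> (C has_real_derivative c u) (at u within {x..y})"
    using integrating_factor[OF c] by blast
  define g where "g = (\<lambda>u. h u * exp (- C u))"
  have g: "(g has_real_derivative R u * exp (- C u)) (at u within {x..y})" if "u \<in> {x..y}" for u
    unfolding g_def using h[OF that] C[OF that]
    by (auto intro!: derivative_eq_intros intro: has_field_derivative_at_within simp: algebra_simps)
  have "\<exists>u. x < u \<and> u < y \<and> (\<lambda>v. R u * exp (- C u) * v) = (\<lambda>v. 0)"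
  proof (rule Rolle_deriv[OF xy])
    show "g x = g y" using assms by (simp add: g_def)
    show "continuous_on {x..y} g" using g by (rule DERIV_continuous_on)
    fix u assume u: "x < u" "u < y"
    then have "(g has_real_derivative R u * exp (- C u)) (at u)"
      using g[of u] by (simp add: at_within_Icc_at)
    then show "(g has_derivative (\<lambda>v. R u * exp (- C u) * v)) (at u)"
      by (simp add: has_field_derivative_def)
  qed
  then obtain u where "x < u" "u < y" "R u * exp (- C u) * 1 = 0" by metis
  then show ?thesis by auto
qed

lemma linear_ode_zero:
  fixes h c :: "real \<Rightarrow> real"
  assumes h: "\<And>u. u \<in> {x..y} \<Longrightarrow> (h has_real_derivative c u * h u) (at u)"
    and c: "continuous_on {x..y} c" and z: "z \<in> {x..y}" "h z = 0" and u: "u \<in> {x..y}"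
  shows "h u = 0"
proof -
  obtain C where C: "\<And>u. u \<in> {x..y} \<Longrightarrow> (C has_real_derivative c u) (at u within {x..y})"
    using integrating_factor[OF c] by blast
  define g where "g = (\<lambda>u. h u * exp (- C u))"
  have g: "(g has_real_derivative 0) (at u within {x..y})" if "u \<in> {x..y}" for u
    unfolding g_def using h[OF that] C[OF that]
    by (auto intro!: derivative_eq_intros intro: has_field_derivative_at_within simp: algebra_simps)
  have "\<exists>k. \<forall>u\<in>{x..y}. g u = k"
    using g by (intro has_field_derivative_zero_constant) auto
  then have "g u = g z" using u z by metis
  then show ?thesis using z by (simp add: g_def)
qed

text \<open>The Euler operator \<open>t * d/dt\<close> on polynomials; it does not raise the degree.\<close>
definition xdiff :: "real poly \<Rightarrow> real poly" where "xdiff p = pCons 0 (pderiv p)"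

lemma poly_xdiff: "poly (xdiff p) t = t * poly (pderiv p) t" by (simp add: xdiff_def)

lemma degree_xdiff: "degree (xdiff p) \<le> degree p"
proof (cases "degree p")
  case 0
  then have "pderiv p = 0" by (metis pderiv_eq_0_iff)
  then show ?thesis by (simp add: xdiff_def)
next
  case (Suc n)
  then show ?thesis unfolding xdiff_def using degree_pCons_le[of 0 "pderiv p"] by (simp add: degree_pderiv)
qed

lemma degree_mult_bound: "degree p \<le> a \<Longrightarrow> degree q \<le> b \<Longrightarrow> a + b \<le> c \<Longrightarrow> degree (p * q) \<le> c"
  using degree_mult_le[of p q] by linarith

lemma degree_lin_bound: "degree [:a, b:] \<le> 1" by simp

lemmas degree_bounds = degree_add_le degree_diff_le degree_smult_le[THEN order_trans]

text \<open>The functions \<open>t * P * A0 + Q * A1\<close> to which the second application of Rolle's theorem refers.\<close>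
definition ode_form :: "real poly \<Rightarrow> real poly \<Rightarrow> real \<Rightarrow> real" where
  "ode_form P Q t = t * poly P t * per_A0 t + poly Q t * per_A1 t"

text \<open>The ratio \<open>\<rho> = A1 / A0\<close> satisfies the Riccati equation
  \<open>t * (1 - 64 * t) * \<rho>' = 4 * t - 32 * t * \<rho> + \<rho>\<^sup>2\<close>. The zeros of the contact polynomial are the points where the
  graph of \<open>- t * P / Q\<close> is tangent to the corresponding direction field; denominators and one factor \<open>t\<close>
  are cleared.\<close>
definition contact_poly :: "real poly \<Rightarrow> real poly \<Rightarrow> real poly" where
  "contact_poly P Q = [:1, -64:] * (P * Q + xdiff P * Q - P * xdiff Q)
     + smult 4 (Q * Q) + smult 32 ([:0, 1:] * (P * Q)) + [:0, 1:] * (P * P)"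

lemma degree_contact_poly:
  assumes "degree P \<le> k" "degree Q \<le> k + 1"
  shows "degree (contact_poly P Q) \<le> 2 * k + 2"
proof -
  have PQ: "degree (P * Q) \<le> 2 * k + 1" "degree (xdiff P * Q) \<le> 2 * k + 1" "degree (P * xdiff Q) \<le> 2 * k + 1"
    "degree (Q * Q) \<le> 2 * k + 2" "degree (P * P) \<le> 2 * k"
    using assms degree_xdiff[of P] degree_xdiff[of Q] by (auto intro!: degree_mult_bound[OF _ _ order_refl, THEN order_trans] intro: order_trans)
  show ?thesis unfolding contact_poly_def
    by (intro degree_bounds degree_mult_bound[OF degree_lin_bound, of _ "2 * k + 1"] PQ order_trans[OF PQ(5)]) auto
qed

abbreviation (input) t_range :: "real set" where "t_range \<equiv> {0<..<1/64}"

text \<open>A difference of a solution of a Riccati equation and an arbitrary function \<open>r\<close> satisfies a linear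
  equation whose inhomogeneity is the defect of \<open>r\<close>.\<close>
lemma ratio_deriv:
  assumes t: "t \<in> t_range" and Q: "poly Q t \<noteq> 0"
  shows "((\<lambda>t. t * poly P t / poly Q t + per_A1 t / per_A0 t) has_real_derivative
     ((per_A1 t / per_A0 t - t * poly P t / poly Q t - 32 * t) / (t * (1 - 64 * t))) * (t * poly P t / poly Q t + per_A1 t / per_A0 t)
     + poly (contact_poly P Q) t / ((1 - 64 * t) * (poly Q t)\<^sup>2)) (at t)"
proof (rule DERIV_cong)
  have t': "0 < t" "t < 1/64" using t by auto
  let ?p = "poly P t" and ?q = "poly Q t" and ?p' = "poly (pderiv P) t" and ?q' = "poly (pderiv Q) t" and ?a = "per_A0 t" and ?b = "per_A1 t"
  have a: "?a \<noteq> 0" using per_A0_pos[OF t'] by simp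
  have D: "1 - 64 * t \<noteq> 0" using t' by simp
  have tp: "((\<lambda>t. t * poly P t) has_real_derivative 1 * ?p + ?p' * t) (at t)"
    by (intro DERIV_mult DERIV_ident poly_DERIV)
  show "((\<lambda>t. t * poly P t / poly Q t + per_A1 t / per_A0 t) has_real_derivative
      ((1 * ?p + ?p' * t) * ?q - (t * ?p) * ?q') / (?q * ?q) +
      ((4 * ?a - 16 * ?b) / (1 - 64 * t) * ?a - ?b * ((16 * t * ?a - ?b) / (t * (1 - 64 * t)))) / (?a * ?a)) (at t)"
    by (intro DERIV_add DERIV_divide tp poly_DERIV per_A0_deriv per_A1_deriv t' Q a)
  define r where "r = ?b / ?a"
  define v where "v = t * ?p / ?q"
  have b: "?b = r * ?a" using a by (simp add: r_def)
  have p: "t * ?p = v * ?q" using Q by (simp add: v_def)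
  have W: "t * poly (contact_poly P Q) t = (1 - 64 * t) * t * (?p * ?q + t * ?p' * ?q - ?p * (t * ?q'))
    + 4 * t * ?q\<^sup>2 + 32 * t * (t * ?p) * ?q + (t * ?p)\<^sup>2"
    by (simp add: contact_poly_def poly_xdiff power2_eq_square algebra_simps)
  have 1: "((4 * ?a - 16 * ?b) / (1 - 64 * t) * ?a - ?b * ((16 * t * ?a - ?b) / (t * (1 - 64 * t)))) / (?a * ?a)
     = (4 * t - 32 * t * r + r\<^sup>2) / (t * (1 - 64 * t))"
    unfolding b using a t' D by (simp add: divide_simps) (simp add: power2_eq_square algebra_simps)
  have 2: "((1 * ?p + ?p' * t) * ?q - (t * ?p) * ?q') / (?q * ?q) =
     poly (contact_poly P Q) t / ((1 - 64 * t) * ?q\<^sup>2) - (4 * t + 32 * t * v + v\<^sup>2) / (t * (1 - 64 * t))"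
  proof -
    have "poly (contact_poly P Q) t / ((1 - 64 * t) * ?q\<^sup>2) = (t * poly (contact_poly P Q) t) / (t * ((1 - 64 * t) * ?q\<^sup>2))"
      using t' by simp
    also have "\<dots> = ((1 - 64 * t) * t * (?p * ?q + t * ?p' * ?q - ?p * (t * ?q')) + (4 * t + 32 * t * v + v\<^sup>2) * ?q\<^sup>2) / (t * ((1 - 64 * t) * ?q\<^sup>2))"
      unfolding W p by (simp add: power2_eq_square algebra_simps)
    also have "\<dots> = ((1 * ?p + ?p' * t) * ?q - (t * ?p) * ?q') / (?q * ?q) + (4 * t + 32 * t * v + v\<^sup>2) / (t * (1 - 64 * t))"
      using Q D t' by (simp add: divide_simps) (simp add: power2_eq_square algebra_simps)
    finally show ?thesis by simp
  qed
  have 3: "(4 * t - 32 * t * r + r\<^sup>2) / (t * (1 - 64 * t)) - (4 * t + 32 * t * v + v\<^sup>2) / (t * (1 - 64 * t))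
     = (r - v - 32 * t) / (t * (1 - 64 * t)) * (v + r)"
    unfolding diff_divide_distrib[symmetric] by (simp add: power2_eq_square algebra_simps)
  show "((1 * ?p + ?p' * t) * ?q - (t * ?p) * ?q') / (?q * ?q) +
      ((4 * ?a - 16 * ?b) / (1 - 64 * t) * ?a - ?b * ((16 * t * ?a - ?b) / (t * (1 - 64 * t)))) / (?a * ?a)
    = ((per_A1 t / per_A0 t - t * poly P t / poly Q t - 32 * t) / (t * (1 - 64 * t))) * (t * poly P t / poly Q t + per_A1 t / per_A0 t)
     + poly (contact_poly P Q) t / ((1 - 64 * t) * (poly Q t)\<^sup>2)"
    unfolding 1 2 using 3 unfolding r_def v_def by linarith
qed

lemma ode_form_zero_iff:
  assumes "t \<in> t_range" "poly Q t \<noteq> 0"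
  shows "ode_form P Q t = 0 \<longleftrightarrow> t * poly P t / poly Q t + per_A1 t / per_A0 t = 0"
proof -
  have a: "per_A0 t \<noteq> 0" using per_A0_pos[of t] assms by auto
  have "ode_form P Q t = (t * poly P t / poly Q t + per_A1 t / per_A0 t) * (poly Q t * per_A0 t)"
    using a assms(2) by (simp add: ode_form_def field_simps)
  then show ?thesis using a assms(2) by simp
qed

lemma ratio_coeff_continuous:
  assumes xy: "{x..y} \<subseteq> t_range" "\<And>u. u \<in> {x..y} \<Longrightarrow> poly Q u \<noteq> 0"
  shows "continuous_on {x..y} (\<lambda>t. (per_A1 t / per_A0 t - t * poly P t / poly Q t - 32 * t) / (t * (1 - 64 * t)))"
proof -
  have c: "continuous_on {x..y} per_A0" "continuous_on {x..y} per_A1"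
    using xy by (auto intro!: DERIV_continuous_on[of _ per_A0] DERIV_continuous_on[of _ per_A1] has_field_derivative_at_within[OF per_A0_deriv] has_field_derivative_at_within[OF per_A1_deriv])
  have nz: "\<forall>u\<in>{x..y}. per_A0 u \<noteq> 0" "\<forall>u\<in>{x..y}. poly Q u \<noteq> 0" "\<forall>u\<in>{x..y}. u * (1 - 64 * u) \<noteq> 0"
  proof -
    show "\<forall>u\<in>{x..y}. per_A0 u \<noteq> 0"
    proof
      fix u assume "u \<in> {x..y}"
      then have "0 < u" "u < 1/64" using xy(1) by auto
      then show "per_A0 u \<noteq> 0" using per_A0_pos[of u] by simp
    qed
    show "\<forall>u\<in>{x..y}. poly Q u \<noteq> 0" using xy(2) by blast
    show "\<forall>u\<in>{x..y}. u * (1 - 64 * u) \<noteq> 0"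
    proof
      fix u assume "u \<in> {x..y}"
      then have "0 < u" "u < 1/64" using xy(1) by auto
      then show "u * (1 - 64 * u) \<noteq> 0" by simp
    qed
  qed
  show ?thesis
    by (intro continuous_on_divide continuous_on_diff continuous_on_mult continuous_on_poly continuous_on_id continuous_on_const c nz)
qed

lemma ode_form_rolle:
  assumes xy: "x < y" "{x..y} \<subseteq> t_range" "\<And>u. u \<in> {x..y} \<Longrightarrow> poly Q u \<noteq> 0"
    and z: "ode_form P Q x = 0" "ode_form P Q y = 0"
  shows "\<exists>u. x < u \<and> u < y \<and> poly (contact_poly P Q) u = 0"
proof -
  let ?h = "\<lambda>t. t * poly P t / poly Q t + per_A1 t / per_A0 t"
  have "\<exists>u. x < u \<and> u < y \<and> poly (contact_poly P Q) u / ((1 - 64 * u) * (poly Q u)\<^sup>2) = 0"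
  proof (rule rolle_linear_ode[OF xy(1) _ ratio_coeff_continuous[OF xy(2,3)]])
    show "(?h has_real_derivative
     ((per_A1 u / per_A0 u - u * poly P u / poly Q u - 32 * u) / (u * (1 - 64 * u))) * ?h u
     + poly (contact_poly P Q) u / ((1 - 64 * u) * (poly Q u)\<^sup>2)) (at u)" if "u \<in> {x..y}" for u
      using that xy by (intro ratio_deriv) auto
    have "x \<in> {x..y}" "y \<in> {x..y}" using xy(1) by auto
    then show "?h x = 0" "?h y = 0"
      using z xy(2,3) ode_form_zero_iff[of x Q P] ode_form_zero_iff[of y Q P] by blast+
  qed
  then obtain u where u: "x < u" "u < y" "poly (contact_poly P Q) u / ((1 - 64 * u) * (poly Q u)\<^sup>2) = 0" by blast
  then have "u \<in> {x..y}" by auto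
  then have "u \<in> t_range" "poly Q u \<noteq> 0" using xy(2,3) by blast+
  then show ?thesis using u by auto
qed

lemma ode_form_const:
  assumes xy: "{x..y} \<subseteq> t_range" "\<And>u. u \<in> {x..y} \<Longrightarrow> poly Q u \<noteq> 0" and W: "contact_poly P Q = 0"
    and z: "z \<in> {x..y}" "ode_form P Q z = 0" and u: "u \<in> {x..y}"
  shows "ode_form P Q u = 0"
proof -
  let ?h = "\<lambda>t. t * poly P t / poly Q t + per_A1 t / per_A0 t"
  have "?h u = 0"
  proof (rule linear_ode_zero[OF _ ratio_coeff_continuous[OF xy] z(1) _ u])
    show "(?h has_real_derivative
     ((per_A1 u / per_A0 u - u * poly P u / poly Q u - 32 * u) / (u * (1 - 64 * u))) * ?h u) (at u)" if "u \<in> {x..y}" for u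
      using that xy ratio_deriv[of u Q P] by (auto simp: W)
    show "?h z = 0" using z xy ode_form_zero_iff[of z Q P] by auto
  qed
  then show ?thesis using u xy ode_form_zero_iff[of u Q P] by auto
qed

lemma poly_roots:
  fixes p :: "real poly"
  assumes "p \<noteq> 0"
  shows "finite {x. poly p x = 0}" "card {x. poly p x = 0} \<le> degree p"
  using assms poly_roots_finite card_poly_roots_bound by auto

text \<open>The second alternative is the degenerate one: off \<open>S\<close>, the function is identically zero or zero free on
  each interval.\<close>
lemma ode_form_zeros:
  assumes deg: "degree P \<le> k" "degree Q \<le> k + 1"
  shows "(finite {t \<in> t_range. ode_form P Q t = 0} \<and> card {t \<in> t_range. ode_form P Q t = 0} \<le> 3 * k + 4) \<or>
    (\<exists>S. finite S \<and> card S \<le> k + 1 \<and> (\<forall>x y z u. {x..y} \<subseteq> t_range - S \<longrightarrow> z \<in> {x..y} \<longrightarrow> ode_form P Q z = 0 \<longrightarrow> u \<in> {x..y} \<longrightarrow> ode_form P Q u = 0))"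
    (is "?A \<or> ?B")
proof -
  let ?Z = "{t \<in> t_range. ode_form P Q t = 0}"
  consider "Q = 0" "P = 0" | "Q = 0" "P \<noteq> 0" | "Q \<noteq> 0" "contact_poly P Q = 0" | "Q \<noteq> 0" "contact_poly P Q \<noteq> 0" by blast
  then show ?thesis
  proof cases
    case 1
    then show ?thesis by (intro disjI2 exI[of _ "{}"]) (simp add: ode_form_def)
  next
    case 2
    have "?Z \<subseteq> {x. poly P x = 0}"
    proof
      fix t assume t: "t \<in> ?Z"
      then have "per_A0 t \<noteq> 0" "t \<noteq> 0" using per_A0_pos[of t] by auto
      then show "t \<in> {x. poly P x = 0}" using t 2 by (auto simp: ode_form_def)
    qed
    then have "finite ?Z" "card ?Z \<le> card {x. poly P x = 0}" using poly_roots[OF 2(2)] by (auto intro: finite_subset card_mono)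
    then show ?thesis using poly_roots(2)[OF 2(2)] deg by linarith
  next
    case 3
    have "?B"
    proof (rule exI[of _ "{x. poly Q x = 0}"], intro conjI allI impI)
      show "finite {x. poly Q x = 0}" "card {x. poly Q x = 0} \<le> k + 1" using poly_roots[OF 3(1)] deg by auto
      fix x y z u assume *: "{x..y} \<subseteq> t_range - {x. poly Q x = 0}" "z \<in> {x..y}" "ode_form P Q z = 0" "u \<in> {x..y}"
      show "ode_form P Q u = 0"
        by (rule ode_form_const[OF _ _ 3(2) *(2,3,4)]) (use *(1) in blast)+
    qed
    then show ?thesis ..
  next
    case 4
    let ?S = "{x. poly Q x = 0}" and ?V = "{x. poly (contact_poly P Q) x = 0}"
    note S = poly_roots[OF 4(1)] and V = poly_roots[OF 4(2)]
    have 1: "finite (?Z - ?S) \<and> card (?Z - ?S) \<le> card (?S \<union> (?V - ?S)) + 1"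
    proof (rule card_le_of_separated)
      show "finite (?S \<union> (?V - ?S))" using S V by auto
      fix x y assume xy: "x \<in> ?Z - ?S" "y \<in> ?Z - ?S" "x < y"
      show "\<exists>e\<in>?S \<union> (?V - ?S). x < e \<and> e < y"
      proof (cases "\<exists>e\<in>?S. x < e \<and> e < y")
        case True then show ?thesis by blast
      next
        case False
        have sub: "{x..y} \<subseteq> t_range" using xy by auto
        have nz: "poly Q u \<noteq> 0" if "u \<in> {x..y}" for u
          using interval_avoids[OF _ _ False that] xy by blast
        obtain u where "x < u" "u < y" "poly (contact_poly P Q) u = 0"
          using ode_form_rolle[OF xy(3) sub nz, of P] xy by auto
        then show ?thesis by auto
      qed
    qed
    \<comment> \<open>A zero at a root of \<open>Q\<close> is a root of \<open>P\<close> too, hence a contact point. It has to be charged to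
      the contact polynomial: charging it to \<open>Q\<close> once more would spoil the bound.\<close>
    have 2: "?Z \<inter> ?S \<subseteq> ?V \<inter> ?S"
    proof
      fix t assume t: "t \<in> ?Z \<inter> ?S"
      then have "per_A0 t \<noteq> 0" "t \<noteq> 0" using per_A0_pos[of t] by auto
      then have "poly P t = 0" using t by (auto simp: ode_form_def)
      then show "t \<in> ?V \<inter> ?S" using t by (auto simp: contact_poly_def)
    qed
    have fin: "finite ?Z" using 1 S by simp
    have "card ?Z \<le> card (?Z - ?S) + card (?Z \<inter> ?S)" by (rule card_split_le)
    also have "\<dots> \<le> (card (?S \<union> (?V - ?S)) + 1) + card (?V \<inter> ?S)"
      using 1 2 V by (intro add_mono card_mono) auto
    also have "\<dots> \<le> (card ?S + card (?V - ?S) + 1) + card (?V \<inter> ?S)" using card_Un_le[of ?S "?V - ?S"] by simp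
    also have "card (?V - ?S) + card (?V \<inter> ?S) = card ?V" using V card_Int_Diff[of ?V ?S] by simp
    then have "(card ?S + card (?V - ?S) + 1) + card (?V \<inter> ?S) = card ?S + card ?V + 1" by linarith
    finally have "card ?Z \<le> card ?S + card ?V + 1" .
    then show ?thesis using fin S V deg degree_contact_poly[OF deg] by linarith
  qed
qed

lemma not_isolated_in_interval:
  fixes Z :: "real set"
  assumes "x < y" "{x..y} \<subseteq> Z" shows "\<not> x isolated_in Z"
proof
  assume "x isolated_in Z"
  then obtain T where T: "open T" "T \<inter> Z = {x}" unfolding isolated_in_def by blast
  then have "x \<in> T" by blast
  then obtain e where e: "e > 0" "ball x e \<subseteq> T" using T(1) open_contains_ball by blast
  define u where "u = x + min (e/2) (y - x)"
  have "u \<in> ball x e" "u \<in> {x..y}" "u \<noteq> x" using e assms by (auto simp: u_def dist_real_def)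
  then show False using T e assms by blast
qed

section \<open>The isolated zeros of combinations of the periods\<close>
theorem module_isolated_zeros:
  fixes \<alpha> \<beta> \<gamma> :: "real poly"
  assumes deg: "degree \<alpha> \<le> d" "degree \<beta> \<le> d" "degree \<gamma> \<le> d"
  defines "f \<equiv> \<lambda>t. poly \<gamma> t * per_K t + poly \<alpha> t * per_B0 t + poly \<beta> t * per_B1 t"
  defines "T \<equiv> {t. t isolated_in {t \<in> t_range. f t = 0}}"
  shows "finite T \<and> card T \<le> 7 * d + 6"
proof -
  have TJ: "t \<in> t_range" "f t = 0" if "t \<in> T" for t using that by (auto simp: T_def isolated_in_def)
  have Tiso: False if "x \<in> T" "x < y" "{x..y} \<subseteq> t_range" "\<And>u. u \<in> {x..y} \<Longrightarrow> f u = 0" for x y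
  proof -
    have "{x..y} \<subseteq> {t \<in> t_range. f t = 0}" using that(3,4) by blast
    then show False using not_isolated_in_interval[OF that(2)] that(1) unfolding T_def by blast
  qed
  \<comment> \<open>The count in the degenerate cases: if no interval off \<open>E\<close> contains two isolated zeros, there are at
    most \<open>card E + 1\<close> of them off \<open>E\<close>.\<close>
  have sepT: "finite T \<and> card T \<le> 2 * card E + 1" if E: "finite E"
    and sep: "\<And>x y. x \<in> T \<Longrightarrow> y \<in> T \<Longrightarrow> x < y \<Longrightarrow> {x..y} \<subseteq> t_range - E \<Longrightarrow> False" for E
  proof -
    have "finite (T - E) \<and> card (T - E) \<le> card E + 1"
    proof (rule card_le_of_separated[OF E], rule ccontr)
      fix x y assume xy: "x \<in> T - E" "y \<in> T - E" "x < y" "\<not> (\<exists>e\<in>E. x < e \<and> e < y)"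
      have "{x..y} \<subseteq> t_range - E"
      proof
        fix u assume u: "u \<in> {x..y}"
        have "x \<in> t_range" "y \<in> t_range" using TJ(1) xy by blast+
        then have "u \<in> t_range" using u by auto
        moreover have "u \<notin> E" using interval_avoids[OF _ _ xy(4) u] xy by blast
        ultimately show "u \<in> t_range - E" by blast
      qed
      then show False using sep xy by blast
    qed
    moreover have "card (T \<inter> E) \<le> card E" using E by (intro card_mono) auto
    ultimately show ?thesis using finite_Diff2[OF E, of T] card_split_le[of T E] by linarith
  qed
  show ?thesis
  proof (cases "\<gamma> = 0")
    case True
    define P where "P = smult (-8/3) \<alpha> - smult (2/15) \<beta>"
    define Q where "Q = smult (1/6) \<alpha> + [:1/30, -8/5:] * \<beta>"
    have dP: "degree P \<le> d" unfolding P_def using deg by (intro degree_bounds) auto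
    have dQ: "degree Q \<le> d + 1" unfolding Q_def using deg by (intro degree_bounds degree_mult_bound[OF degree_lin_bound, of _ d]) auto
    have f: "f t = ode_form P Q t" if "t \<in> t_range" for t
      using that by (simp add: f_def True ode_form_def P_def Q_def per_B_per_A algebra_simps)
    from ode_form_zeros[OF dP dQ] show ?thesis
    proof
      assume A: "finite {t \<in> t_range. ode_form P Q t = 0} \<and> card {t \<in> t_range. ode_form P Q t = 0} \<le> 3 * d + 4"
      have "T \<subseteq> {t \<in> t_range. ode_form P Q t = 0}" using TJ f by force
      then have "finite T" "card T \<le> card {t \<in> t_range. ode_form P Q t = 0}" using A by (auto intro: finite_subset card_mono)
      then show ?thesis using A by linarith
    next
      assume "\<exists>S. finite S \<and> card S \<le> d + 1 \<and> (\<forall>x y z u. {x..y} \<subseteq> t_range - S \<longrightarrow> z \<in> {x..y} \<longrightarrow> ode_form P Q z = 0 \<longrightarrow> u \<in> {x..y} \<longrightarrow> ode_form P Q u = 0)"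
      then obtain S where S: "finite S" "card S \<le> d + 1"
        and const: "\<And>x y z u. {x..y} \<subseteq> t_range - S \<Longrightarrow> z \<in> {x..y} \<Longrightarrow> ode_form P Q z = 0 \<Longrightarrow> u \<in> {x..y} \<Longrightarrow> ode_form P Q u = 0" by blast
      have "finite T \<and> card T \<le> 2 * card S + 1"
      proof (rule sepT[OF S(1)])
        fix x y assume xy: "x \<in> T" "y \<in> T" "x < y" "{x..y} \<subseteq> t_range - S"
        show False
        proof (rule Tiso[OF xy(1,3)])
          show "{x..y} \<subseteq> t_range" using xy by blast
          fix u assume u: "u \<in> {x..y}"
          have "ode_form P Q x = 0" using TJ[OF xy(1)] f[of x] by auto
          then have "ode_form P Q u = 0" using const[OF xy(4), of x u] u xy by auto
          then show "f u = 0" using f[of u] u xy(4) by auto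
        qed
      qed
      then show ?thesis using S by linarith
    qed
  next
    case False
    define U where "U = (\<lambda>\<alpha>. \<gamma> * xdiff \<alpha> - (xdiff \<gamma> + smult (1/2) \<gamma>) * \<alpha>)"
    define P where "P = smult (-2) (\<alpha> * \<gamma>) - smult (8/3) (U \<alpha>) - smult (2/15) (U \<beta>)"
    define Q where "Q = smult (1/6) (U \<alpha>) + [:1/30, -8/5:] * U \<beta> - smult 2 ([:0, 1:] * (\<gamma> * \<beta>)) - smult (1/2) (\<gamma> * \<gamma>)"
    have dU: "degree (U p) \<le> 2 * d" if "degree p \<le> d" for p
      unfolding U_def using that deg degree_xdiff[of p] degree_xdiff[of \<gamma>]
      by (intro degree_bounds degree_mult_bound[of _ d _ d]) auto
    have dP: "degree P \<le> 2 * d" unfolding P_def using deg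
      by (intro degree_bounds degree_mult_bound[of _ d _ d] dU) auto
    have dQ: "degree Q \<le> 2 * d + 1" unfolding Q_def using deg
      by (intro degree_bounds degree_mult_bound[OF degree_lin_bound, of _ "2 * d"] degree_mult_bound[of _ d _ d] order_trans[OF dU] dU) auto
    \<comment> \<open>The numerator of the derivative of \<open>f / (\<gamma> * sqrt t)\<close>.\<close>
    have F: "ode_form P Q t = poly \<gamma> t * t * (poly (pderiv \<alpha>) t * per_B0 t + poly (pderiv \<beta>) t * per_B1 t - 2 * poly \<alpha> t * per_A0 t - 2 * poly \<beta> t * per_A1 t)
        - (poly \<alpha> t * per_B0 t + poly \<beta> t * per_B1 t) * (poly (pderiv \<gamma>) t * t + poly \<gamma> t / 2) - (poly \<gamma> t)\<^sup>2 * per_A1 t / 2" if t: "t \<in> t_range" for t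
    proof -
      have u: "poly (U p) t = poly \<gamma> t * t * poly (pderiv p) t - (poly (pderiv \<gamma>) t * t + poly \<gamma> t / 2) * poly p t" for p
        by (simp add: U_def poly_xdiff algebra_simps)
      have "ode_form P Q t = poly (U \<alpha>) t * per_B0 t + poly (U \<beta>) t * per_B1 t - 2 * t * poly \<gamma> t * (poly \<alpha> t * per_A0 t + poly \<beta> t * per_A1 t) - (poly \<gamma> t)\<^sup>2 * per_A1 t / 2"
        using t by (simp add: ode_form_def P_def Q_def per_B_per_A power2_eq_square algebra_simps)
      then show ?thesis unfolding u by (simp add: algebra_simps)
    qed
    let ?h = "\<lambda>t. f t / (poly \<gamma> t * sqrt t)"
    have h: "(?h has_real_derivative ode_form P Q t / ((poly \<gamma> t)\<^sup>2 * t * sqrt t)) (at t)" if t: "t \<in> t_range" "poly \<gamma> t \<noteq> 0" for t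
    proof (rule DERIV_cong)
      have t': "0 < t" "t < 1/64" using t by auto
      have st: "sqrt t \<noteq> 0" using t' by simp
      let ?f' = "poly (pderiv \<gamma>) t * per_K t + (per_K t - per_A1 t) / (2 * t) * poly \<gamma> t + (poly (pderiv \<alpha>) t * per_B0 t + (- 2 * per_A0 t) * poly \<alpha> t)
         + (poly (pderiv \<beta>) t * per_B1 t + (- 2 * per_A1 t) * poly \<beta> t)"
      let ?g' = "poly (pderiv \<gamma>) t * sqrt t + (inverse (sqrt t) / 2) * poly \<gamma> t"
      have f': "(f has_real_derivative ?f') (at t)" unfolding f_def
        by (intro DERIV_add DERIV_mult poly_DERIV per_K_deriv per_B0_deriv per_B1_deriv t')
      show "(?h has_real_derivative (?f' * (poly \<gamma> t * sqrt t) - f t * ?g') / ((poly \<gamma> t * sqrt t) * (poly \<gamma> t * sqrt t))) (at t)"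
        using t(2) st by (intro DERIV_divide f' DERIV_mult poly_DERIV DERIV_real_sqrt t') auto
      define r where "r = sqrt t"
      have r: "r \<noteq> 0" "t = r * r" using t' by (auto simp: r_def)
      show "(?f' * (poly \<gamma> t * sqrt t) - f t * ?g') / ((poly \<gamma> t * sqrt t) * (poly \<gamma> t * sqrt t)) = ode_form P Q t / ((poly \<gamma> t)\<^sup>2 * t * sqrt t)"
      proof -
        have "(?f' * (poly \<gamma> t * sqrt t) - f t * ?g') * r = ode_form P Q t"
        proof -
          have "(?f' * (poly \<gamma> t * r) - f t * (poly (pderiv \<gamma>) t * r + (inverse r / 2) * poly \<gamma> t)) * r
             = ?f' * poly \<gamma> t * (r * r) - f t * (poly (pderiv \<gamma>) t * (r * r) + poly \<gamma> t / 2)"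
            using r(1) by (simp add: field_simps)
          also have "\<dots> = ode_form P Q t"
            unfolding r(2)[symmetric] F[OF t(1)] f_def using t' by (simp add: field_simps power2_eq_square)
          finally show ?thesis unfolding r_def .
        qed
        then have "ode_form P Q t / ((poly \<gamma> t)\<^sup>2 * t * r) = ((?f' * (poly \<gamma> t * sqrt t) - f t * ?g') * r) / ((poly \<gamma> t)\<^sup>2 * t * r)" by simp
        also have "\<dots> = (?f' * (poly \<gamma> t * sqrt t) - f t * ?g') / ((poly \<gamma> t)\<^sup>2 * t)" using r by simp
        finally have e: "ode_form P Q t / ((poly \<gamma> t)\<^sup>2 * t * r) = (?f' * (poly \<gamma> t * sqrt t) - f t * ?g') / ((poly \<gamma> t)\<^sup>2 * t)" .
        have sq: "(poly \<gamma> t * sqrt t) * (poly \<gamma> t * sqrt t) = (poly \<gamma> t)\<^sup>2 * t" using t' by (simp add: power2_eq_square)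
        show ?thesis unfolding sq using e unfolding r_def by (rule sym)
      qed
    qed
    have hz: "?h t = 0 \<longleftrightarrow> f t = 0" if "t \<in> t_range" "poly \<gamma> t \<noteq> 0" for t using that by auto
    let ?G = "{x. poly \<gamma> x = 0}"
    note G = poly_roots[OF False]
    have rolle: "\<exists>u. x < u \<and> u < y \<and> ode_form P Q u = 0" if xy: "x < y" "{x..y} \<subseteq> t_range - ?G" "f x = 0" "f y = 0" for x y
    proof -
      have "\<exists>u. x < u \<and> u < y \<and> ode_form P Q u / ((poly \<gamma> u)\<^sup>2 * u * sqrt u) = 0"
      proof (rule rolle_linear_ode[OF xy(1), of ?h "\<lambda>_. 0"])
        show "(?h has_real_derivative 0 * ?h u + ode_form P Q u / ((poly \<gamma> u)\<^sup>2 * u * sqrt u)) (at u)" if "u \<in> {x..y}" for u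
        proof -
          have "u \<in> t_range" "poly \<gamma> u \<noteq> 0" using that xy(2) by blast+
          then show ?thesis using h[of u] by simp
        qed
      qed (use xy in auto)
      then obtain u where u: "x < u" "u < y" "ode_form P Q u / ((poly \<gamma> u)\<^sup>2 * u * sqrt u) = 0" by blast
      then have "u \<in> t_range - ?G" using xy(2) by (auto simp: subset_iff)
      then show ?thesis using u by auto
    qed
    from ode_form_zeros[OF dP dQ] show ?thesis
    proof
      let ?Z = "{t \<in> t_range. ode_form P Q t = 0}"
      assume A: "finite ?Z \<and> card ?Z \<le> 3 * (2 * d) + 4"
      have 1: "finite (T - ?G) \<and> card (T - ?G) \<le> card (?G \<union> (?Z - ?G)) + 1"
      proof (rule card_le_of_separated)
        show "finite (?G \<union> (?Z - ?G))" using A G by auto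
        fix x y assume xy: "x \<in> T - ?G" "y \<in> T - ?G" "x < y"
        show "\<exists>e\<in>?G \<union> (?Z - ?G). x < e \<and> e < y"
        proof (cases "\<exists>e\<in>?G. x < e \<and> e < y")
          case True then show ?thesis by blast
        next
          case F: False
          have sub: "{x..y} \<subseteq> t_range - ?G"
          proof
            fix u assume u: "u \<in> {x..y}"
            have "x \<in> t_range" "y \<in> t_range" using TJ(1) xy by blast+
            then have "u \<in> t_range" using u by auto
            moreover have "u \<notin> ?G" using interval_avoids[OF _ _ F u] xy by blast
            ultimately show "u \<in> t_range - ?G" by blast
          qed
          obtain u where u: "x < u" "u < y" "ode_form P Q u = 0"
            using rolle[OF xy(3) sub] TJ xy by blast
          then have "u \<in> t_range - ?G" using sub by (auto simp: subset_iff)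
          then show ?thesis using u by blast
        qed
      qed
      \<comment> \<open>A common zero of \<open>f\<close> and \<open>\<gamma>\<close> is a zero of the numerator and is charged to it, not to \<open>\<gamma>\<close>.\<close>
      have 2: "T \<inter> ?G \<subseteq> ?Z \<inter> ?G"
      proof
        fix t assume t: "t \<in> T \<inter> ?G"
        then have "t \<in> t_range" "f t = 0" "poly \<gamma> t = 0" using TJ by auto
        then have "ode_form P Q t = 0" unfolding F[OF \<open>t \<in> t_range\<close>] by (simp add: f_def)
        then show "t \<in> ?Z \<inter> ?G" using t TJ by auto
      qed
      have fin: "finite T" using 1 G by simp
      have "card T \<le> card (T - ?G) + card (T \<inter> ?G)" by (rule card_split_le)
      also have "\<dots> \<le> (card (?G \<union> (?Z - ?G)) + 1) + card (?Z \<inter> ?G)"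
        using 1 2 A by (intro add_mono card_mono) auto
      also have "\<dots> \<le> (card ?G + card (?Z - ?G) + 1) + card (?Z \<inter> ?G)" using card_Un_le[of ?G "?Z - ?G"] by simp
      also have "card (?Z - ?G) + card (?Z \<inter> ?G) = card ?Z" using A card_Int_Diff[of ?Z ?G] by simp
      then have "(card ?G + card (?Z - ?G) + 1) + card (?Z \<inter> ?G) = card ?G + card ?Z + 1" by linarith
      finally have "card T \<le> card ?G + card ?Z + 1" .
      then show ?thesis using fin G A deg by linarith
    next
      assume "\<exists>S. finite S \<and> card S \<le> 2 * d + 1 \<and> (\<forall>x y z u. {x..y} \<subseteq> t_range - S \<longrightarrow> z \<in> {x..y} \<longrightarrow> ode_form P Q z = 0 \<longrightarrow> u \<in> {x..y} \<longrightarrow> ode_form P Q u = 0)"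
      then obtain S where S: "finite S" "card S \<le> 2 * d + 1"
        and const: "\<And>x y z u. {x..y} \<subseteq> t_range - S \<Longrightarrow> z \<in> {x..y} \<Longrightarrow> ode_form P Q z = 0 \<Longrightarrow> u \<in> {x..y} \<Longrightarrow> ode_form P Q u = 0" by blast
      have "finite T \<and> card T \<le> 2 * card (?G \<union> S) + 1"
      proof (rule sepT)
        show "finite (?G \<union> S)" using G S by auto
        fix x y assume xy: "x \<in> T" "y \<in> T" "x < y" "{x..y} \<subseteq> t_range - (?G \<union> S)"
        have subG: "{x..y} \<subseteq> t_range - ?G" and subS: "{x..y} \<subseteq> t_range - S" using xy(4) by auto
        obtain z where z: "x < z" "z < y" "ode_form P Q z = 0" using rolle[OF xy(3) subG] TJ xy by blast
        have Fz: "ode_form P Q u = 0" if "u \<in> {x..y}" for u using const[OF subS _ z(3) that] z by auto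
        show False
        proof (rule Tiso[OF xy(1,3)])
          show "{x..y} \<subseteq> t_range" using xy by blast
          fix u assume u: "u \<in> {x..y}"
          have "?h u = 0"
          proof (rule linear_ode_zero[of x y ?h "\<lambda>_. 0" x u])
            show "(?h has_real_derivative 0 * ?h u) (at u)" if "u \<in> {x..y}" for u
            proof -
              have "u \<in> t_range" "poly \<gamma> u \<noteq> 0" using that subG by blast+
              then show ?thesis using h[of u] Fz[OF that] by simp
            qed
          qed (use u xy TJ in auto)
          moreover have "u \<in> t_range" "poly \<gamma> u \<noteq> 0" using u subG by blast+
          ultimately show "f u = 0" using hz[of u] by blast
        qed
      qed
      then show ?thesis using S G deg card_Un_le[of ?G S] by linarith
    qed
  qed
qed

section \<open>The oval as a component of the level curve\<close>

text \<open>The point of the oval \<open>H = s\<^sup>2 / 4\<close> with angle \<open>\<phi>\<close>.\<close>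
definition oval_point :: "real \<Rightarrow> real \<Rightarrow> real \<times> real" where
  "oval_point s \<phi> = (xpar s \<phi>, ypar s \<phi>)"

text \<open>The inverse of \<open>oval_point\<close>, with the angle \<open>\<phi>\<close> encoded as the point \<open>cis \<phi>\<close> of the unit circle.\<close>
definition oval_angle :: "real \<Rightarrow> real \<times> real \<Rightarrow> complex" where
  "oval_angle s z = Complex (fst z * (2 * snd z - 1 + fst z) / (sqrt (1/4 - s) * sqrt (fst z * (1 - fst z) + s)))
     ((fst z - 1/2) / sqrt (1/4 - s))"

context
  fixes s :: real
  assumes s: "0 < s" "s < 1/4"
begin

lemma H_split: "4 * H (x, y) = x\<^sup>2 * (1 - x)\<^sup>2 - (x * (2 * y - 1 + x))\<^sup>2"
  by (simp add: H_def power2_eq_square algebra_simps)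

lemma vpar_ypar: "xpar s \<phi> * (2 * ypar s \<phi> - 1 + xpar s \<phi>) = vpar s \<phi>"
  using xpar_nz[OF s, of \<phi>] by (simp add: ypar_def field_simps)

lemma H_oval_point: "H (oval_point s \<phi>) = s\<^sup>2 / 4"
proof -
  have "4 * H (oval_point s \<phi>) = (xpar s \<phi> * (1 - xpar s \<phi>))\<^sup>2 - (vpar s \<phi>)\<^sup>2"
    unfolding oval_point_def H_split vpar_ypar by (simp add: power_mult_distrib)
  also have "\<dots> = s\<^sup>2" unfolding xpar_zpar[OF s] vpar_sq[OF s] by simp
  finally show ?thesis by simp
qed

lemma oval_angle_oval_point: "oval_angle s (oval_point s \<phi>) = cis \<phi>"
proof -
  have k: "sqrt (1/4 - s) \<noteq> 0" using s by simp
  have "sqrt (1/4 - s) * sqrt (xpar s \<phi> * (1 - xpar s \<phi>) + s) \<noteq> 0"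
    using k rpar_nz[OF s, of \<phi>] unfolding xpar_zpar[OF s] rpar_def by simp
  moreover have "vpar s \<phi> = cos \<phi> * (sqrt (1/4 - s) * sqrt (xpar s \<phi> * (1 - xpar s \<phi>) + s))"
    unfolding xpar_zpar[OF s] by (simp add: vpar_def dxpar_def rpar_def)
  ultimately have "vpar s \<phi> / (sqrt (1/4 - s) * sqrt (xpar s \<phi> * (1 - xpar s \<phi>) + s)) = cos \<phi>" by simp
  moreover have "(xpar s \<phi> - 1/2) / sqrt (1/4 - s) = sin \<phi>" using k by (simp add: xpar_def)
  ultimately show ?thesis by (simp add: oval_angle_def oval_point_def vpar_ypar cis.code)
qed

lemma oval_point_cong: "sin \<phi> = sin \<psi> \<Longrightarrow> cos \<phi> = cos \<psi> \<Longrightarrow> oval_point s \<phi> = oval_point s \<psi>"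
  by (simp add: oval_point_def xpar_def ypar_def vpar_def dxpar_def rpar_def zpar_def)

lemma oval_point_surj:
  assumes H: "H (x, y) = s\<^sup>2 / 4" and x: "0 < x" "x < 1"
  shows "(x, y) \<in> oval_point s ` {0..2*pi}"
proof -
  define k where "k = sqrt (1/4 - s)"
  have k: "k > 0" "k * k = 1/4 - s" using s by (auto simp: k_def)
  define z where "z = x * (1 - x)"
  have z: "z > 0" using x by (simp add: z_def)
  define v where "v = x * (2 * y - 1 + x)"
  have v2: "v\<^sup>2 = z\<^sup>2 - s\<^sup>2" using H_split[of x y] H by (simp add: v_def z_def power_mult_distrib)
  define D where "D = sqrt (z + s)"
  have D: "D > 0" "D * D = z + s" using z s by (auto simp: D_def)
  have "((v / (k * D))\<^sup>2 + ((x - 1/2) / k)\<^sup>2) * ((k * k) * (D * D)) = v\<^sup>2 + (x - 1/2)\<^sup>2 * (D * D)"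
    using k(1) D(1) by (simp add: field_simps power2_eq_square)
  also have "\<dots> = (k * k) * (D * D)"
    unfolding v2 k D by (simp add: z_def power2_eq_square algebra_simps)
  finally have "(v / (k * D))\<^sup>2 + ((x - 1/2) / k)\<^sup>2 = 1"
    using k(1) D(1) by simp
  then obtain \<phi> where p: "0 \<le> \<phi>" "\<phi> < 2 * pi" "v / (k * D) = cos \<phi>" "(x - 1/2) / k = sin \<phi>"
    using sincos_total_2pi by metis
  have x': "xpar s \<phi> = x" using k(1) by (simp add: xpar_def p(4)[symmetric] k_def[symmetric])
  have "zpar s \<phi> = z" unfolding xpar_zpar[OF s, symmetric] x' z_def ..
  then have "rpar s \<phi> = D" by (simp add: rpar_def D_def)
  then have "vpar s \<phi> = v" using k(1) D(1) by (simp add: vpar_def dxpar_def p(3)[symmetric] k_def[symmetric])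
  then have "ypar s \<phi> = y" unfolding ypar_def x' v_def using x by (simp add: field_simps)
  then have "(x, y) = oval_point s \<phi>" using x' by (simp add: oval_point_def)
  then show ?thesis using p by auto
qed

lemma oval_point_continuous: "continuous_on S (oval_point s)"
proof -
  have "oval_point s = (\<lambda>\<phi>. (xpar s \<phi>, ypar s \<phi>))" by (rule ext) (rule oval_point_def)
  then show ?thesis by (auto intro: continuous_on_Pair param_continuous[OF s])
qed

lemma oval_point_image: "oval_point s ` {0..2*pi} = {z. H z = s\<^sup>2 / 4 \<and> 0 < fst z \<and> fst z < 1}" (is "?I = ?C")
proof
  show "?I \<subseteq> ?C" using H_oval_point xpar_bounds[OF s] by (auto simp: oval_point_def)
  show "?C \<subseteq> ?I" using oval_point_surj by auto
qed

lemma range_oval_point: "range (oval_point s) = oval_point s ` {0..2*pi}"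
proof
  show "range (oval_point s) \<subseteq> oval_point s ` {0..2*pi}"
    unfolding oval_point_image using H_oval_point xpar_bounds[OF s] by (auto simp: oval_point_def)
qed auto

lemma H_fst_not_01: "H z = s\<^sup>2 / 4 \<Longrightarrow> fst z \<noteq> 0 \<and> fst z \<noteq> 1"
proof -
  assume H: "H z = s\<^sup>2 / 4"
  have "s\<^sup>2 / 4 > 0" using s by simp
  moreover have "H (0, b) = 0" "H (1, b) \<le> 0" for b using zero_le_square[of b] by (simp_all add: H_def)
  ultimately show ?thesis using H by (metis linorder_not_less order_refl prod.collapse)
qed

text \<open>The condition on \<open>R\<close> says that both branches of the level curve exist over \<open>R\<close>; the one through \<open>(x, y)\<close>
  is then an unbounded connected subset of the level curve. It is used with \<open>R\<close> the half-line from \<open>x\<close>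
  pointing away from \<open>[0, 1]\<close>.\<close>
lemma unbounded_component:
  assumes H: "H (x, y) = s\<^sup>2 / 4" and R: "connected R" "x \<in> R" "\<not> bounded R"
    and R2: "\<And>r. r \<in> R \<Longrightarrow> r \<noteq> 0 \<and> s \<le> \<bar>r * (1 - r)\<bar>"
  shows "\<not> bounded (connected_component_set {z. H z = s\<^sup>2 / 4} (x, y))"
proof
  let ?K = "connected_component_set {z. H z = s\<^sup>2 / 4} (x, y)"
  assume bdd: "bounded ?K"
  define w where "w = 2 * y - 1 + x"
  define \<sigma> :: real where "\<sigma> = (if w \<ge> 0 then 1 else -1)"
  define f where "f = (\<lambda>r. (r, (1 - r + \<sigma> * sqrt ((1 - r)\<^sup>2 - s\<^sup>2 / r\<^sup>2)) / 2))"
  have pos: "(1 - r)\<^sup>2 - s\<^sup>2 / r\<^sup>2 \<ge> 0" if "r \<in> R" for r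
  proof -
    have "s\<^sup>2 \<le> (r * (1 - r))\<^sup>2" using R2[OF that] s by (intro abs_le_square_iff[THEN iffD1]) auto
    then have "s\<^sup>2 \<le> (1 - r)\<^sup>2 * r\<^sup>2" by (simp only: power_mult_distrib mult.commute)
    then have "s\<^sup>2 / r\<^sup>2 \<le> (1 - r)\<^sup>2" using R2[OF that] by (simp add: divide_le_eq)
    then show ?thesis by simp
  qed
  have fH: "H (f r) = s\<^sup>2 / 4" if r: "r \<in> R" for r
  proof -
    have w: "2 * snd (f r) - 1 + r = \<sigma> * sqrt ((1 - r)\<^sup>2 - s\<^sup>2 / r\<^sup>2)"
    proof -
      have "2 * ((1 - r + q) / 2) - 1 + r = q" for q by (simp add: field_simps)
      then show ?thesis unfolding f_def snd_conv .
    qed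
    have "\<sigma>\<^sup>2 = 1" by (simp add: \<sigma>_def)
    then have "(r * (2 * snd (f r) - 1 + r))\<^sup>2 = r\<^sup>2 * (sqrt ((1 - r)\<^sup>2 - s\<^sup>2 / r\<^sup>2))\<^sup>2"
      unfolding w by (simp only: power_mult_distrib mult_1)
    also have "\<dots> = r\<^sup>2 * (1 - r)\<^sup>2 - s\<^sup>2" using pos[OF r] R2[OF r] by (simp add: field_simps)
    finally show ?thesis using H_split[of r "snd (f r)"] by (simp add: f_def)
  qed
  have fx: "f x = (x, y)"
  proof -
    have "s\<^sup>2 = x\<^sup>2 * (1 - x)\<^sup>2 - (x * w)\<^sup>2" unfolding w_def using H_split[of x y] H by simp
    then have "w\<^sup>2 = (1 - x)\<^sup>2 - s\<^sup>2 / x\<^sup>2"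
      using R2[OF R(2)] by (simp add: field_simps)
    then have "sqrt ((1 - x)\<^sup>2 - s\<^sup>2 / x\<^sup>2) = \<bar>w\<bar>" by (metis real_sqrt_abs)
    then have "\<sigma> * sqrt ((1 - x)\<^sup>2 - s\<^sup>2 / x\<^sup>2) = w" by (simp add: \<sigma>_def)
    then show ?thesis by (simp add: f_def w_def)
  qed
  have "continuous_on R f" unfolding f_def using R2 by (intro continuous_intros) auto
  then have "connected (f ` R)" using R(1) by (rule connected_continuous_image)
  then have "f ` R \<subseteq> ?K"
    using fH fx R(2) by (intro connected_component_maximal) (auto intro: image_eqI[of _ f x])
  then have "bounded (fst ` f ` R)" using bdd bounded_subset bounded_fst by (metis image_mono)
  moreover have "fst ` f ` R = R" by (auto simp: f_def image_image)
  ultimately show False using R(3) by simp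
qed

lemma oval_point_component:
  assumes p: "p \<in> oval_point s ` {0..2*pi}"
  shows "connected_component_set {z. H z = s\<^sup>2 / 4} p = oval_point s ` {0..2*pi}" (is "?K = ?C")
proof
  have C: "connected ?C" by (intro connected_continuous_image oval_point_continuous) simp
  then show "?C \<subseteq> ?K" using p by (intro connected_component_maximal) (auto simp: H_oval_point)
  have K: "is_interval (fst ` ?K)"
    unfolding is_interval_connected_1 by (intro connected_continuous_image continuous_intros) simp
  have iv: "a \<in> fst ` ?K \<Longrightarrow> b \<in> fst ` ?K \<Longrightarrow> a \<le> u \<Longrightarrow> u \<le> b \<Longrightarrow> u \<in> fst ` ?K" for a b u
    using K unfolding is_interval_1 by blast
  have nK: "0 \<notin> fst ` ?K" "1 \<notin> fst ` ?K"
    using connected_component_subset[of "{z. H z = s\<^sup>2 / 4}" p] H_fst_not_01 by fastforce+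
  have pC: "p \<in> {z. H z = s\<^sup>2 / 4 \<and> 0 < fst z \<and> fst z < 1}" using p unfolding oval_point_image .
  then have pK: "fst p \<in> fst ` ?K" by (intro imageI) (simp add: connected_component_refl)
  show "?K \<subseteq> ?C"
  proof
    fix q assume q: "q \<in> ?K"
    then have "H q = s\<^sup>2 / 4" using connected_component_subset[of "{z. H z = s\<^sup>2 / 4}" p] by blast
    moreover have "0 < fst q"
    proof (rule ccontr)
      assume "\<not> 0 < fst q"
      then have "0 \<in> fst ` ?K" using pC by (intro iv[OF imageI[OF q] pK]) auto
      then show False using nK by simp
    qed
    moreover have "fst q < 1"
    proof (rule ccontr)
      assume "\<not> fst q < 1"
      then have "1 \<in> fst ` ?K" using pC by (intro iv[OF pK imageI[OF q]]) auto
      then show False using nK by simp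
    qed
    ultimately show "q \<in> ?C" unfolding oval_point_image by simp
  qed
qed

lemma oval_eq: "oval (s\<^sup>2 / 4) = range (oval_point s)"
  unfolding oval_def range_oval_point
proof (rule the_equality)
  let ?C = "oval_point s ` {0..2*pi}" and ?L = "{z. H z = s\<^sup>2 / 4}"
  have "oval_point s 0 \<in> ?C" by simp
  then have "?C \<in> components ?L" using oval_point_component[of "oval_point s 0"] H_oval_point[of 0] unfolding components_iff
    by (intro exI[of _ "oval_point s 0"]) simp
  moreover have "compact ?C" by (intro compact_continuous_image oval_point_continuous) simp
  ultimately show "?C \<in> components ?L \<and> compact ?C" ..
  fix K assume K: "K \<in> components ?L \<and> compact K"
  then obtain p where p: "p \<in> ?L" "K = connected_component_set ?L p" unfolding components_iff by blast
  obtain x y where xy: "p = (x, y)" by (cases p)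
  have H: "H (x, y) = s\<^sup>2 / 4" using p xy by simp
  have bdd: "bounded (connected_component_set ?L (x, y))" using K p xy by (auto intro: compact_imp_bounded)
  have sz: "s \<le> \<bar>x * (1 - x)\<bar>"
  proof -
    have "s\<^sup>2 \<le> (x * (1 - x))\<^sup>2" using H_split[of x y] H zero_le_power2[of "x * (2 * y - 1 + x)"] by (simp add: power_mult_distrib)
    then show ?thesis using s abs_le_square_iff[of s "x * (1 - x)"] by simp
  qed
  have "\<not> 1 < x"
  proof
    assume x: "1 < x"
    have "\<not> bounded {x..}"
    proof
      assume "bounded {x..}"
      then obtain B where B: "\<And>r. x \<le> r \<Longrightarrow> \<bar>r\<bar> \<le> B" unfolding bounded_real by auto
      show False using B[of "max x (\<bar>B\<bar> + 1)"] by auto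
    qed
    moreover have "r \<noteq> 0 \<and> s \<le> \<bar>r * (1 - r)\<bar>" if "r \<in> {x..}" for r
    proof -
      have "x * (x - 1) \<le> r * (r - 1)" using x that by (intro mult_mono) auto
      moreover have "\<bar>x * (1 - x)\<bar> = x * (x - 1)" "\<bar>r * (1 - r)\<bar> = r * (r - 1)" using x that by (auto simp: abs_mult)
      ultimately show ?thesis using x that sz by auto
    qed
    ultimately show False using unbounded_component[OF H, of "{x..}"] bdd by auto
  qed
  moreover have "\<not> x < 0"
  proof
    assume x: "x < 0"
    have "\<not> bounded {..x}"
    proof
      assume "bounded {..x}"
      then obtain B where B: "\<And>r. r \<le> x \<Longrightarrow> \<bar>r\<bar> \<le> B" unfolding bounded_real by auto
      show False using B[of "min x (- \<bar>B\<bar> - 1)"] by auto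
    qed
    moreover have "r \<noteq> 0 \<and> s \<le> \<bar>r * (1 - r)\<bar>" if "r \<in> {..x}" for r
    proof -
      have "(-x) * (1 - x) \<le> (-r) * (1 - r)" using x that by (intro mult_mono) auto
      moreover have "\<bar>x * (1 - x)\<bar> = (-x) * (1 - x)" "\<bar>r * (1 - r)\<bar> = (-r) * (1 - r)" using x that by (auto simp: abs_mult)
      ultimately show ?thesis using x that sz by auto
    qed
    ultimately show False using unbounded_component[OF H, of "{..x}"] bdd by auto
  qed
  ultimately have "p \<in> ?C" unfolding oval_point_image using H H_fst_not_01[OF H] xy by auto
  then show "K = ?C" using oval_point_component p(2) by simp
qed

end

section \<open>Line integrals along arbitrary parametrizations of the oval\<close>
lemma continuous_antiderivative:
  fixes f :: "real \<Rightarrow> real"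
  assumes f: "continuous_on UNIV f"
  obtains \<Phi> where "\<And>\<phi>. (\<Phi> has_real_derivative f \<phi>) (at \<phi>)"
proof
  let ?\<Phi> = "\<lambda>\<phi>. integral {0..\<phi>} f - integral {\<phi>..0} f"
  fix \<phi>0 :: real
  define N where "N = \<bar>\<phi>0\<bar> + 1"
  have int: "f integrable_on {a..b}" for a b
    by (rule integrable_continuous_interval) (rule continuous_on_subset[OF f], simp)
  have N: "\<phi>0 \<in> {-N<..<N}" "-N \<le> 0" by (auto simp: N_def)
  have eq: "integral {-N..\<phi>} f - integral {-N..0} f = ?\<Phi> \<phi>" if "\<phi> \<in> {-N<..<N}" for \<phi>
  proof (cases "\<phi> \<ge> 0")
    case True
    have "integral {-N..0} f + integral {0..\<phi>} f = integral {-N..\<phi>} f"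
      using True N by (intro Henstock_Kurzweil_Integration.integral_combine int) auto
    moreover have "integral {\<phi>..0} f = 0" using True by (cases "\<phi> = 0") auto
    ultimately show ?thesis by simp
  next
    case False
    have "integral {-N..\<phi>} f + integral {\<phi>..0} f = integral {-N..0} f"
      using False that by (intro Henstock_Kurzweil_Integration.integral_combine int) auto
    then show ?thesis using False by simp
  qed
  have "((\<lambda>\<phi>. integral {-N..\<phi>} f) has_real_derivative f \<phi>0) (at \<phi>0 within {-N..N})"
    using N by (intro integral_has_real_derivative continuous_on_subset[OF f]) auto
  then have "((\<lambda>\<phi>. integral {-N..\<phi>} f) has_real_derivative f \<phi>0) (at \<phi>0)"
    using N by (subst (asm) at_within_Icc_at) auto
  then have "((\<lambda>\<phi>. integral {-N..\<phi>} f - integral {-N..0} f) has_real_derivative f \<phi>0 - 0) (at \<phi>0)"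
    by (intro DERIV_diff DERIV_const)
  then show "(?\<Phi> has_real_derivative f \<phi>0) (at \<phi>0)"
    unfolding diff_0_right
    by (rule has_field_derivative_transform_within_open[of _ _ _ "{-N<..<N}"]) (use eq N in auto)
qed

lemma antiderivative_periodic:
  assumes \<Phi>: "\<And>\<phi>. (\<Phi> has_real_derivative f \<phi>) (at \<phi>)" and per: "\<And>\<phi>. f (\<phi> + 2 * pi) = f \<phi>"
  shows "\<Phi> (\<phi> + 2 * pi * of_int m) = \<Phi> \<phi> + of_int m * cycle_int f"
proof -
  have "((\<lambda>\<phi>. \<Phi> (\<phi> + 2 * pi) - \<Phi> \<phi>) has_real_derivative 0) (at \<phi>)" for \<phi>
  proof (rule DERIV_cong)
    show "((\<lambda>\<phi>. \<Phi> (\<phi> + 2 * pi) - \<Phi> \<phi>) has_real_derivative f (\<phi> + 2 * pi) * 1 - f \<phi>) (at \<phi>)"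
      by (intro DERIV_diff \<Phi> DERIV_chain2[of \<Phi>]) (auto intro!: derivative_eq_intros)
  qed (simp add: per)
  then have const: "\<Phi> (a + 2 * pi) - \<Phi> a = \<Phi> (b + 2 * pi) - \<Phi> b" for a b
    using DERIV_isconst_all[of "\<lambda>\<phi>. \<Phi> (\<phi> + 2 * pi) - \<Phi> \<phi>" a b] by simp
  have "(f has_integral (\<Phi> pi - \<Phi> (-pi))) {-pi..pi}"
    using \<Phi> by (intro fundamental_theorem_of_calculus)
      (auto simp: has_real_derivative_iff_has_vector_derivative[symmetric] intro: has_field_derivative_at_within)
  then have "cycle_int f = \<Phi> pi - \<Phi> (-pi)" by (simp add: cycle_int_def integral_unique)
  then have step: "\<Phi> (a + 2 * pi) = \<Phi> a + cycle_int f" for a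
    using const[of a "-pi"] by simp
  have nat: "\<Phi> (a + 2 * pi * real k) = \<Phi> a + real k * cycle_int f" for a k
  proof (induction k)
    case (Suc k)
    show ?case using step[of "a + 2 * pi * real k"] Suc by (simp add: algebra_simps)
  qed simp
  show ?thesis
  proof (cases "m \<ge> 0")
    case True
    then show ?thesis using nat[of \<phi> "nat m"] by simp
  next
    case False
    have "\<Phi> (\<phi> + 2 * pi * of_int m + 2 * pi * real (nat (-m))) = \<Phi> (\<phi> + 2 * pi * of_int m) + real (nat (-m)) * cycle_int f"
      by (rule nat)
    then show ?thesis using False by (simp add: algebra_simps)
  qed
qed

text \<open>A continuous angle is differentiable wherever its sine and cosine are: near \<open>\<tau>\<close> it equals
  \<open>\<psi> \<tau> + arcsin (sin (\<psi> u - \<psi> \<tau>))\<close>.\<close>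
lemma deriv_of_angle:
  fixes \<psi> :: "real \<Rightarrow> real"
  assumes cont: "isCont \<psi> \<tau>"
    and "(\<lambda>u. sin (\<psi> u)) differentiable at \<tau>" "(\<lambda>u. cos (\<psi> u)) differentiable at \<tau>"
  shows "\<exists>d. (\<psi> has_real_derivative d) (at \<tau>)"
proof -
  obtain S' C' where S: "((\<lambda>u. sin (\<psi> u)) has_real_derivative S') (at \<tau>)" and C: "((\<lambda>u. cos (\<psi> u)) has_real_derivative C') (at \<tau>)"
    using assms(2,3) by (auto simp: real_differentiable_def)
  define m where "m = (\<lambda>u. sin (\<psi> u) * cos (\<psi> \<tau>) - cos (\<psi> u) * sin (\<psi> \<tau>))"
  have m: "(m has_real_derivative (S' * cos (\<psi> \<tau>) - C' * sin (\<psi> \<tau>))) (at \<tau>)"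
    unfolding m_def by (intro DERIV_diff DERIV_cmult_right S C)
  have m0: "m \<tau> = 0" by (simp add: m_def mult.commute)
  have ms: "m u = sin (\<psi> u - \<psi> \<tau>)" for u by (simp add: m_def sin_diff)
  have "(arcsin has_real_derivative inverse (sqrt (1 - (m \<tau>)\<^sup>2))) (at (m \<tau>))"
    unfolding m0 by (rule DERIV_arcsin) auto
  from DERIV_chain2[OF this m] have "((\<lambda>u. arcsin (m u)) has_real_derivative (S' * cos (\<psi> \<tau>) - C' * sin (\<psi> \<tau>))) (at \<tau>)"
    by (simp add: m0)
  then have d: "((\<lambda>u. arcsin (m u) + \<psi> \<tau>) has_real_derivative (S' * cos (\<psi> \<tau>) - C' * sin (\<psi> \<tau>)) + 0) (at \<tau>)"
    by (intro DERIV_add DERIV_const)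
  have "eventually (\<lambda>u. dist (\<psi> u) (\<psi> \<tau>) < pi / 2) (at \<tau>)"
    using cont unfolding isCont_def tendsto_iff by (rule allE[of _ "pi / 2"]) simp
  then have "eventually (\<lambda>u. arcsin (m u) + \<psi> \<tau> = \<psi> u) (at \<tau>)"
  proof (rule eventually_mono)
    fix u assume "dist (\<psi> u) (\<psi> \<tau>) < pi / 2"
    then have "\<bar>\<psi> u - \<psi> \<tau>\<bar> < pi / 2" by (simp add: dist_real_def)
    then have "arcsin (sin (\<psi> u - \<psi> \<tau>)) = \<psi> u - \<psi> \<tau>" by (intro arcsin_sin) linarith+
    then show "arcsin (m u) + \<psi> \<tau> = \<psi> u" by (simp add: ms)
  qed
  then have "(\<psi> has_real_derivative (S' * cos (\<psi> \<tau>) - C' * sin (\<psi> \<tau>)) + 0) (at \<tau>)"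
    using d has_field_derivative_cong_eventually[of "\<lambda>u. arcsin (m u) + \<psi> \<tau>" \<psi> \<tau> UNIV] by (simp add: m0)
  then show ?thesis by blast
qed

text \<open>The two alternatives exhibit the failure of injectivity of a map on the circle \<open>[0, 1] / {0, 1}\<close> to the
  line.\<close>
lemma continuous_repeated_value:
  fixes \<psi> :: "real \<Rightarrow> real"
  assumes c: "continuous_on {0..1} \<psi>" and e: "\<psi> 0 = \<psi> 1"
  obtains u w where "0 < u" "u < w" "w < 1" "\<psi> u = \<psi> w" | u where "0 < u" "u < 1" "\<psi> u = \<psi> 0"
proof (cases "\<psi> (1/2) = \<psi> 0")
  case True
  then show ?thesis using that(2)[of "1/2"] by simp
next
  case False
  define d where "d = (\<psi> 0 + \<psi> (1/2)) / 2"
  have c1: "continuous_on {0..1/2} \<psi>" and c2: "continuous_on {1/2..1} \<psi>"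
    by (rule continuous_on_subset[OF c]; force)+
  have d: "d \<noteq> \<psi> 0" "d \<noteq> \<psi> (1/2)" using False by (auto simp: d_def field_simps)
  obtain u where u: "0 \<le> u" "u \<le> 1/2" "\<psi> u = d"
  proof (cases "\<psi> 0 \<le> \<psi> (1/2)")
    case True
    then show ?thesis using IVT'[of \<psi> 0 d "1/2"] c1 that by (auto simp: d_def)
  next
    case False
    then show ?thesis using IVT2'[of \<psi> "1/2" d 0] c1 that by (auto simp: d_def)
  qed
  obtain w where w: "1/2 \<le> w" "w \<le> 1" "\<psi> w = d"
  proof (cases "\<psi> 0 \<le> \<psi> (1/2)")
    case True
    then show ?thesis using IVT2'[of \<psi> 1 d "1/2"] c2 that e by (auto simp: d_def)
  next
    case False
    then show ?thesis using IVT'[of \<psi> "1/2" d 1] c2 that e by (auto simp: d_def)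
  qed
  have "u \<noteq> 0" "u \<noteq> 1/2" "w \<noteq> 1/2" "w \<noteq> 1" using u w d e by metis+
  then show ?thesis using u w by (intro that(1)[of u w]) auto
qed

lemma cis_eqD: "cis a = cis b \<Longrightarrow> sin a = sin b \<and> cos a = cos b"
  by (simp add: complex_eq_iff)

text \<open>The path is lifted to a continuous angle \<open>\<psi>\<close>, whose total increase is \<open>2 * pi * m\<close> for an integer \<open>m\<close>;
  the path is simple, so \<open>m \<noteq> 0\<close>.\<close>
lemma line_integral_oval:
  assumes s: "0 < s" "s < 1/4"
    and valid: "valid_path g" and simple: "simple_path g" and closed: "pathfinish g = pathstart g"
    and img: "path_image g \<subseteq> range (oval_point s)"
  shows "\<exists>m. m \<noteq> 0 \<and> line_integral p q g = m * form_int p q s"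
proof -
  define k where "k = sqrt (1/4 - s)"
  have k: "k > 0" using s by (simp add: k_def)
  have cont_g: "continuous_on {0..1} g" using valid valid_path_imp_path by (auto simp: path_def)
  obtain S where S: "finite S" "g C1_differentiable_on ({0..1} - S)"
    using valid by (auto simp: valid_path_def piecewise_C1_differentiable_on_def)
  have ex: "\<exists>\<phi>. g \<tau> = oval_point s \<phi>" if "\<tau> \<in> {0..1}" for \<tau>
  proof -
    have "g \<tau> \<in> range (oval_point s)" using img that unfolding path_image_def by blast
    then show ?thesis by blast
  qed
  have den: "k * sqrt (fst (g \<tau>) * (1 - fst (g \<tau>)) + s) \<noteq> 0 \<and> fst (g \<tau>) * (1 - fst (g \<tau>)) + s > 0" if \<tau>: "\<tau> \<in> {0..1}" for \<tau>
  proof -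
    obtain \<phi> where "g \<tau> = oval_point s \<phi>" using ex[OF \<tau>] by blast
    then have "fst (g \<tau>) * (1 - fst (g \<tau>)) = zpar s \<phi>" using xpar_zpar[OF s] by (simp add: oval_point_def)
    then show ?thesis using zpar_pos[OF s, of \<phi>] s k by simp
  qed
  define e where "e = (\<lambda>\<tau>. oval_angle s (g \<tau>))"
  have e_eq: "e \<tau> = Complex (fst (g \<tau>) * (2 * snd (g \<tau>) - 1 + fst (g \<tau>)) / (k * sqrt (fst (g \<tau>) * (1 - fst (g \<tau>)) + s))) ((fst (g \<tau>) - 1/2) / k)" for \<tau>
    by (simp add: e_def oval_angle_def k_def)
  have norm_e: "norm (e \<tau>) = 1" if "\<tau> \<in> {0..1}" for \<tau>
    using ex[OF that] oval_angle_oval_point[OF s] by (auto simp: e_def)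
  have "continuous_on {0..1} e"
    unfolding e_eq[abs_def] continuous_complex_iff complex.sel
    using den k by (intro continuous_intros cont_g conjI ballI) auto
  then obtain L where L: "continuous_on {0..1} L" "\<And>\<tau>. \<tau> \<in> {0..1} \<Longrightarrow> e \<tau> = exp (L \<tau>)"
    using continuous_logarithm_on_contractible[of "{0..1}" e] norm_e
    by (metis convex_imp_contractible convex_real_interval(5) norm_zero zero_neq_one)
  define \<psi> where "\<psi> = (\<lambda>\<tau>. Im (L \<tau>))"
  have \<psi>_cont: "continuous_on {0..1} \<psi>" unfolding \<psi>_def by (intro continuous_intros L)
  have e_cis: "e \<tau> = cis (\<psi> \<tau>)" if "\<tau> \<in> {0..1}" for \<tau>
  proof -
    have "exp (Re (L \<tau>)) = 1" using norm_e[OF that] L(2)[OF that] by simp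
    then have "Re (L \<tau>) = 0" by simp
    then show ?thesis using L(2)[OF that] unfolding exp_eq_polar by (simp add: \<psi>_def)
  qed
  have g_oval_point: "g \<tau> = oval_point s (\<psi> \<tau>)" if \<tau>: "\<tau> \<in> {0..1}" for \<tau>
  proof -
    obtain \<phi> where \<phi>: "g \<tau> = oval_point s \<phi>" using ex \<tau> by blast
    then have "cis \<phi> = cis (\<psi> \<tau>)" using e_cis[OF \<tau>] oval_angle_oval_point[OF s] by (simp add: e_def)
    then have "sin \<phi> = sin (\<psi> \<tau>) \<and> cos \<phi> = cos (\<psi> \<tau>)" by (rule cis_eqD)
    then show ?thesis using \<phi> oval_point_cong[OF s, of \<phi> "\<psi> \<tau>"] by simp
  qed
  define f where "f = (\<lambda>\<phi>. eval2 p (xpar s \<phi>, ypar s \<phi>) * dxpar s \<phi> + eval2 q (xpar s \<phi>, ypar s \<phi>) * dypar s \<phi>)"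
  have f_cont: "continuous_on UNIV f" unfolding f_def
    by (intro continuous_on_add continuous_on_mult eval2_continuous[OF s] param_continuous[OF s] dypar_continuous[OF s])
  have f_per: "f (\<phi> + 2 * pi) = f \<phi>" for \<phi>
    by (simp add: f_def xpar_def ypar_def dxpar_def dypar_def vpar_def dvpar_def rpar_def zpar_def)
  obtain \<Phi> where \<Phi>: "\<And>\<phi>. (\<Phi> has_real_derivative f \<phi>) (at \<phi>)"
    using continuous_antiderivative[OF f_cont] by blast
  let ?F = "\<lambda>\<tau>. eval2 p (g \<tau>) * fst (vector_derivative g (at \<tau> within {0..1})) +
     eval2 q (g \<tau>) * snd (vector_derivative g (at \<tau> within {0..1}))"
  have deriv: "((\<lambda>\<tau>. \<Phi> (\<psi> \<tau>)) has_vector_derivative ?F \<tau>) (at \<tau>)" if \<tau>: "\<tau> \<in> {0<..<1} - S" for \<tau>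
  proof -
    have \<tau>01: "\<tau> \<in> {0..1}" using \<tau> by auto
    have ev: "eventually (\<lambda>u. u \<in> {0..1}) (at \<tau>)"
      using \<tau> by (intro eventually_at_in_open'[of "{0<..<1}", THEN eventually_mono]) auto
    obtain g' where g': "(g has_vector_derivative g') (at \<tau>)"
    proof -
      have "\<tau> \<in> {0..1} - S" using \<tau> by auto
      then show ?thesis using S(2) that unfolding C1_differentiable_on_def by blast
    qed
    have gx: "((\<lambda>u. fst (g u)) has_real_derivative fst g') (at \<tau>)"
      using bounded_linear.has_vector_derivative[OF bounded_linear_fst g'] by (simp add: has_real_derivative_iff_has_vector_derivative)
    have gy: "((\<lambda>u. snd (g u)) has_real_derivative snd g') (at \<tau>)"
      using bounded_linear.has_vector_derivative[OF bounded_linear_snd g'] by (simp add: has_real_derivative_iff_has_vector_derivative)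
    have dx: "(\<lambda>u. fst (g u)) differentiable at \<tau>" and dy: "(\<lambda>u. snd (g u)) differentiable at \<tau>"
      using gx gy real_differentiable_def by blast+
    have ds: "(\<lambda>u. sqrt (fst (g u) * (1 - fst (g u)) + s)) differentiable at \<tau>"
    proof -
      have "((\<lambda>u. fst (g u) * (1 - fst (g u)) + s) has_real_derivative fst g' * (1 - fst (g \<tau>)) + (0 - fst g') * fst (g \<tau>) + 0) (at \<tau>)"
        by (intro DERIV_add DERIV_mult DERIV_diff DERIV_const gx)
      from DERIV_chain2[OF DERIV_real_sqrt this] show ?thesis
        using den[OF \<tau>01] real_differentiable_def by blast
    qed
    have "(\<lambda>u. Re (e u)) differentiable at \<tau>" "(\<lambda>u. Im (e u)) differentiable at \<tau>"
      unfolding e_eq complex.sel using den[OF \<tau>01] k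
      by (intro derivative_intros dx dy ds; simp)+
    moreover have "eventually (\<lambda>u. Re (e u) = cos (\<psi> u)) (at \<tau>)" "eventually (\<lambda>u. Im (e u) = sin (\<psi> u)) (at \<tau>)"
      using ev by (auto elim!: eventually_mono simp: e_cis)
    moreover have "Re (e \<tau>) = cos (\<psi> \<tau>)" "Im (e \<tau>) = sin (\<psi> \<tau>)" using e_cis[OF \<tau>01] by auto
    ultimately have "(\<lambda>u. cos (\<psi> u)) differentiable at \<tau>" "(\<lambda>u. sin (\<psi> u)) differentiable at \<tau>"
      using has_field_derivative_cong_eventually[of _ _ \<tau> UNIV] unfolding real_differentiable_def by metis+
    moreover have "isCont \<psi> \<tau>" using \<psi>_cont \<tau> by (intro continuous_on_interior[of "{0..1}"]) auto
    ultimately obtain d where d: "(\<psi> has_real_derivative d) (at \<tau>)" using deriv_of_angle by blast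
    have "((\<lambda>u. (xpar s (\<psi> u), ypar s (\<psi> u))) has_vector_derivative (dxpar s (\<psi> \<tau>) * d, dypar s (\<psi> \<tau>) * d)) (at \<tau>)"
      by (intro has_vector_derivative_Pair has_real_derivative_iff_has_vector_derivative[THEN iffD1]
        DERIV_chain2[OF xpar_deriv[OF s] d] DERIV_chain2[OF ypar_deriv[OF s] d])
    then have "(g has_vector_derivative (dxpar s (\<psi> \<tau>) * d, dypar s (\<psi> \<tau>) * d)) (at \<tau>)"
      by (rule has_vector_derivative_transform_within_open[of _ _ _ "{0<..<1}"])
        (use \<tau> g_oval_point in \<open>auto simp: oval_point_def\<close>)
    then have "vector_derivative g (at \<tau> within {0..1}) = (dxpar s (\<psi> \<tau>) * d, dypar s (\<psi> \<tau>) * d)"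
      using \<tau>01 by (intro vector_derivative_at_within_ivl) auto
    then have "?F \<tau> = f (\<psi> \<tau>) * d" using g_oval_point[OF \<tau>01] by (simp add: f_def oval_point_def algebra_simps)
    then show ?thesis using DERIV_chain2[OF \<Phi> d] by (simp add: has_real_derivative_iff_has_vector_derivative)
  qed
  have "(?F has_integral \<Phi> (\<psi> 1) - \<Phi> (\<psi> 0)) {0..1}"
  proof (rule fundamental_theorem_of_calculus_interior_strong[OF S(1) _ deriv])
    have "continuous_on UNIV \<Phi>" using \<Phi> by (intro DERIV_continuous_on) (auto intro: has_field_derivative_at_within)
    then show "continuous_on {0..1} (\<lambda>\<tau>. \<Phi> (\<psi> \<tau>))" using \<psi>_cont by (rule continuous_on_compose2) simp
  qed auto
  then have li: "line_integral p q g = \<Phi> (\<psi> 1) - \<Phi> (\<psi> 0)" unfolding line_integral_def by (rule integral_unique)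
  have "g 0 = g 1" using closed by (simp add: pathfinish_def pathstart_def)
  then have "cis (\<psi> 0) = cis (\<psi> 1)" using e_cis[of 0] e_cis[of 1] by (simp add: e_def)
  then have "sin (\<psi> 1) = sin (\<psi> 0) \<and> cos (\<psi> 1) = cos (\<psi> 0)"
    using cis_eqD[of "\<psi> 1" "\<psi> 0"] by simp
  then obtain m :: int where m: "\<psi> 1 = \<psi> 0 + 2 * pi * of_int m" unfolding sin_cos_eq_iff by blast
  have "m \<noteq> 0"
  proof
    assume "m = 0"
    then have "\<psi> 0 = \<psi> 1" using m by simp
    have inj: False if "u \<in> {0..1}" "w \<in> {0<..<1}" "u \<noteq> w" "\<psi> u = \<psi> w" for u w
    proof -
      have "g u = g w" using g_oval_point that by simp
      moreover have "w \<in> {0..1}" using that(2) by auto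
      ultimately have "u = w \<or> u = 0 \<and> w = 1 \<or> u = 1 \<and> w = 0"
        using simple that(1) unfolding simple_path_def loop_free_def by blast
      then show False using that by auto
    qed
    show False
      by (rule continuous_repeated_value[OF \<psi>_cont \<open>\<psi> 0 = \<psi> 1\<close>]) (use inj in force)+
  qed
  moreover have "line_integral p q g = of_int m * form_int p q s"
    unfolding li m antiderivative_periodic[of \<Phi> f, OF \<Phi> f_per] by (simp add: form_int_def f_def)
  ultimately show ?thesis by (intro exI[of _ "of_int m"]) simp
qed

section \<open>The bound on the number of zeros\<close>
theorem theorem1p1:
  fixes p q :: "real poly poly" and n :: nat
    and \<gamma> :: "real \<Rightarrow> real \<Rightarrow> real \<times> real" and I :: "real \<Rightarrow> real"
  assumes n: "n = form_degree p q"
    and \<gamma>: "oval_family \<gamma>"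
    and I: "\<And>t. t \<in> {0<..<1/64} \<Longrightarrow> I t = line_integral p q (\<gamma> t)"
  shows "finite {t. t isolated_in {t \<in> {0<..<1/64}. I t = 0}} \<and>
    real (card {t. t isolated_in {t \<in> {0<..<1/64}. I t = 0}}) \<le> 7 / 4 * real n + 9"
proof -
  obtain a b c :: "real poly" where deg: "4 * degree a \<le> n" "4 * degree b \<le> n" "4 * degree c \<le> n"
    and form: "\<And>s. 0 < s \<Longrightarrow> s < 1/4 \<Longrightarrow> form_int p q s = poly c (s\<^sup>2/4) * int_v inverse s
        + poly a (s\<^sup>2/4) * int_v (\<lambda>_. 1) s + poly b (s\<^sup>2/4) * int_v (\<lambda>z. z) s"
  proof -
    have "petrov_module n (form_int p q)" unfolding n by (rule petrov_module_form_int)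
    then show ?thesis unfolding petrov_module_def using that by (elim exE conjE) blast
  qed
  define f where "f = (\<lambda>t. poly c t * per_K t + poly a t * per_B0 t + poly b t * per_B1 t)"
  have zero: "I t = 0 \<longleftrightarrow> f t = 0" if t: "t \<in> {0<..<1/64}" for t
  proof -
    have t': "0 < t" "t < 1/64" using t by auto
    define s where "s = 2 * sqrt t"
    have s: "0 < s" "s < 1/4" unfolding s_def by (fact s_bounds[OF t'])+
    have st: "s\<^sup>2 / 4 = t" using t' by (simp add: s_def power_mult_distrib)
    have path: "valid_path (\<gamma> t)" "simple_path (\<gamma> t)" "pathfinish (\<gamma> t) = pathstart (\<gamma> t)" "path_image (\<gamma> t) = oval t"
      using \<gamma> t unfolding oval_family_def by blast+
    have "path_image (\<gamma> t) \<subseteq> range (oval_point s)" using path(4) oval_eq[OF s] unfolding st by (simp only: order_refl)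
    then obtain m where "m \<noteq> 0" "line_integral p q (\<gamma> t) = m * form_int p q s"
      using line_integral_oval[OF s path(1-3)] by blast
    moreover have "form_int p q s = f t"
      using form[OF s] unfolding st by (simp add: f_def per_K_def per_B0_def per_B1_def s_def)
    ultimately show ?thesis using I[OF t] by simp
  qed
  have eq: "{t \<in> {0<..<1/64}. I t = 0} = {t \<in> {0<..<1/64}. f t = 0}"
    by (intro Collect_cong conj_cong refl zero)
  have deg': "degree a \<le> n div 4" "degree b \<le> n div 4" "degree c \<le> n div 4" using deg by auto
  have bound: "finite {t. t isolated_in {t \<in> {0<..<1/64}. f t = 0}}"
    "card {t. t isolated_in {t \<in> {0<..<1/64}. f t = 0}} \<le> 7 * (n div 4) + 6"
    using module_isolated_zeros[OF deg'] unfolding f_def by blast+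
  have "real (4 * (n div 4)) \<le> real n" unfolding of_nat_le_iff by simp
  then have "real (7 * (n div 4) + 6) \<le> 7 / 4 * real n + 9" by simp
  moreover have "real (card {t. t isolated_in {t \<in> {0<..<1/64}. f t = 0}}) \<le> real (7 * (n div 4) + 6)"
    using bound(2) by (simp only: of_nat_le_iff)
  ultimately show ?thesis unfolding eq using bound(1) by linarith
qed

end
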